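(* For a locally convex space $E$ the following conditions are equivalent: (i) $E$ has the Josefson--Nissenzweig property; (ii) there exists a continuous linear operator $T:E\to C_p^0(\omega)$ which is not $\beta$-to-$\beta$ precompact; (iii) for some locally convex space $Y$ with the strong Gelfand--Phillips property, there exists a continuous linear operator $T:E\to Y$ which is not $\beta$-to-$\beta$ precompact; (iv) for some locally convex space $Y$ with the Gelfand--Phillips property, there exists a continuous linear operator $T:E\to Y$ which is not $\beta$-to-$\beta$ precompact.
   Context: All locally convex spaces are Hausdorff and infinite-dimensional over the field $\mathbb{F}$ of real or complex numbers. For a locally convex space $E$, $E'$ is the space of continuous linear functionals. A barrel is a closed absolutely convex absorbing subset. A set $B\subseteq E$ is barrel-bounded if for every barrel $U\subseteq E$ there is $n\in\omega$ with $B\subseteq nU$. A set $A\subseteq E$ is barrel-precompact if for every barrel $U\subseteq E$ there is a finite set $F\subseteq E$ with $A\subseteq F+U$. For $B\subseteq E$ and $\chi\in E'$, $\|\chi\|_B:=\sup\{|\chi(x)|:x\in B\cup\{0\}\}$. Josefson--Nissenzweig property: the identity map $\big(E',\sigma(E',E)\big)\to\big(E',\beta^\ast(E',E)\big)$ is not sequentially continuous, where $\beta^\ast(E',E)$ is the topology on $E'$ whose neighborhood base at zero consists of the polars of barrel-bounded subsets of $E$. Strong Gelfand--Phillips property: there is a weak$^\ast$ null sequence $\{\chi_n\}_{n\in\omega}$ in $E'$ such that $\|\chi_n\|_B\not\to 0$ for every barrel-bounded set $B\subseteq E$ which is not barrel-precompact. Gelfand--Phillips property: every limited subset of $E$ is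 barrel-precompact, where a bounded set $A\subseteq E$ is limited if $\lim_n\|\chi_n\|_A=0$ for every weak$^\ast$ null sequence $\{\chi_n\}_{n\in\omega}$ in $E'$. A linear operator $T:X\to Y$ between locally convex spaces is $\beta$-to-$\beta$ precompact if for every barrel-bounded set $B\subseteq X$ the image $T(B)$ is barrel-precompact in $Y$. $C_p^0(\omega)$ is the vector space $c_0$ of null sequences in $\mathbb{F}^\omega$ endowed with the topology of pointwise (coordinatewise) convergence. *)

theory Defs
  imports
    "HOL-Analysis.Analysis"
    "HOL-Algebra.Algebraic_Closure_Type"
    "Jordan_Normal_Form.Missing_VectorSpace"
begin

text \<open>
  The scalar field is a type of sort \<open>{real_normed_field, euclidean_space}\<close>: its instances are, up to
  isomorphism, exactly the real and the complex field. Vector spaces are carrier-based, so that one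
  can quantify existentially over all spaces supported by a given type. The fields \<open>mult\<close> and
  \<open>one\<close> inherited from \<^typ>\<open>('k, 'a) module\<close> play no role.
\<close>

record ('k, 'a) tvs = "('k, 'a) module" +
  vtop :: "'a topology"

abbreviation scalars :: "'k::{real_normed_field, euclidean_space} ring"
  where "scalars \<equiv> ring_of_type_algebra"


section \<open>Locally convex spaces\<close>

definition nbhd0 :: "('k, 'a) tvs \<Rightarrow> 'a set \<Rightarrow> bool"
  where "nbhd0 E U \<longleftrightarrow> U \<subseteq> carrier E \<and> (\<exists>W. openin (vtop E) W \<and> \<zero>\<^bsub>E\<^esub> \<in> W \<and> W \<subseteq> U)"

definition convex_in :: "('k::{real_normed_field, euclidean_space}, 'a) tvs \<Rightarrow> 'a set \<Rightarrow> bool"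
  where "convex_in E U \<longleftrightarrow> U \<subseteq> carrier E \<and>
    (\<forall>x\<in>U. \<forall>y\<in>U. \<forall>t\<in>{0..1::real}.
      of_real (1 - t) \<odot>\<^bsub>E\<^esub> x \<oplus>\<^bsub>E\<^esub> of_real t \<odot>\<^bsub>E\<^esub> y \<in> U)"

text \<open>Hausdorff and infinite-dimensional, as assumed throughout.\<close>

definition lcs :: "('k::{real_normed_field, euclidean_space}, 'a) tvs \<Rightarrow> bool"
  where "lcs E \<longleftrightarrow>
    vectorspace scalars E \<and>
    topspace (vtop E) = carrier E \<and>
    continuous_map (prod_topology (vtop E) (vtop E)) (vtop E) (\<lambda>(x, y). x \<oplus>\<^bsub>E\<^esub> y) \<and>
    continuous_map (prod_topology euclidean (vtop E)) (vtop E) (\<lambda>(c, x). c \<odot>\<^bsub>E\<^esub> x) \<and>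
    (\<forall>U. nbhd0 E U \<longrightarrow> (\<exists>V. nbhd0 E V \<and> convex_in E V \<and> V \<subseteq> U)) \<and>
    Hausdorff_space (vtop E) \<and>
    \<not> vectorspace.fin_dim scalars E"

definition scale_set :: "('k, 'a) tvs \<Rightarrow> 'k \<Rightarrow> 'a set \<Rightarrow> 'a set"
  where "scale_set E c U = (\<lambda>x. c \<odot>\<^bsub>E\<^esub> x) ` U"

definition absorbs :: "('k::{real_normed_field, euclidean_space}, 'a) tvs \<Rightarrow> 'a set \<Rightarrow> 'a set \<Rightarrow> bool"
  where "absorbs E U A \<longleftrightarrow> (\<exists>r>0. \<forall>c. norm c \<ge> r \<longrightarrow> A \<subseteq> scale_set E c U)"

definition absorbing :: "('k::{real_normed_field, euclidean_space}, 'a) tvs \<Rightarrow> 'a set \<Rightarrow> bool"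
  where "absorbing E U \<longleftrightarrow> U \<subseteq> carrier E \<and> (\<forall>x\<in>carrier E. absorbs E U {x})"

definition bounded_in :: "('k::{real_normed_field, euclidean_space}, 'a) tvs \<Rightarrow> 'a set \<Rightarrow> bool"
  where "bounded_in E A \<longleftrightarrow> A \<subseteq> carrier E \<and> (\<forall>U. nbhd0 E U \<longrightarrow> absorbs E U A)"

definition abs_convex_in :: "('k::{real_normed_field, euclidean_space}, 'a) tvs \<Rightarrow> 'a set \<Rightarrow> bool"
  where "abs_convex_in E U \<longleftrightarrow> U \<subseteq> carrier E \<and>
    (\<forall>x\<in>U. \<forall>y\<in>U. \<forall>a b. norm a + norm b \<le> 1 \<longrightarrow> a \<odot>\<^bsub>E\<^esub> x \<oplus>\<^bsub>E\<^esub> b \<odot>\<^bsub>E\<^esub> y \<in> U)"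

definition barrel :: "('k::{real_normed_field, euclidean_space}, 'a) tvs \<Rightarrow> 'a set \<Rightarrow> bool"
  where "barrel E U \<longleftrightarrow> closedin (vtop E) U \<and> abs_convex_in E U \<and> absorbing E U"

definition barrel_bounded :: "('k::{real_normed_field, euclidean_space}, 'a) tvs \<Rightarrow> 'a set \<Rightarrow> bool"
  where "barrel_bounded E B \<longleftrightarrow> B \<subseteq> carrier E \<and>
    (\<forall>U. barrel E U \<longrightarrow> (\<exists>n::nat. B \<subseteq> scale_set E (of_nat n) U))"

definition barrel_precompact :: "('k::{real_normed_field, euclidean_space}, 'a) tvs \<Rightarrow> 'a set \<Rightarrow> bool"
  where "barrel_precompact E A \<longleftrightarrow> A \<subseteq> carrier E \<and>
    (\<forall>U. barrel E U \<longrightarrow> (\<exists>F. finite F \<and> F \<subseteq> carrier E \<and> A \<subseteq> F <+>\<^bsub>E\<^esub> U))"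


section \<open>The dual and its topologies\<close>

text \<open>Functionals are \<open>undefined\<close> outside the carrier, so that equality in the dual is equality of
  functions, and the product topology over the index set \<open>carrier E\<close> applies.\<close>

definition dual :: "('k::{real_normed_field, euclidean_space}, 'a) tvs \<Rightarrow> ('a \<Rightarrow> 'k) set"
  where "dual E = {\<phi> \<in> extensional (carrier E).
    (\<forall>x\<in>carrier E. \<forall>y\<in>carrier E. \<phi> (x \<oplus>\<^bsub>E\<^esub> y) = \<phi> x + \<phi> y) \<and>
    (\<forall>c. \<forall>x\<in>carrier E. \<phi> (c \<odot>\<^bsub>E\<^esub> x) = c * \<phi> x) \<and>
    continuous_map (vtop E) euclidean \<phi>}"

definition weak_star :: "('k::{real_normed_field, euclidean_space}, 'a) tvs \<Rightarrow> ('a \<Rightarrow> 'k) topology"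
  where "weak_star E = subtopology (product_topology (\<lambda>_. euclidean) (carrier E)) (dual E)"

definition polar :: "('k::{real_normed_field, euclidean_space}, 'a) tvs \<Rightarrow> 'a set \<Rightarrow> ('a \<Rightarrow> 'k) set"
  where "polar E B = {\<phi> \<in> dual E. \<forall>x\<in>B. norm (\<phi> x) \<le> 1}"

definition dual_diff :: "('k::{real_normed_field, euclidean_space}, 'a) tvs \<Rightarrow> ('a \<Rightarrow> 'k) \<Rightarrow> ('a \<Rightarrow> 'k) \<Rightarrow> 'a \<Rightarrow> 'k"
  where "dual_diff E \<psi> \<phi> = (\<lambda>x\<in>carrier E. \<psi> x - \<phi> x)"

definition beta_star_open :: "('k::{real_normed_field, euclidean_space}, 'a) tvs \<Rightarrow> ('a \<Rightarrow> 'k) set \<Rightarrow> bool"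
  where "beta_star_open E W \<longleftrightarrow> W \<subseteq> dual E \<and>
    (\<forall>\<phi>\<in>W. \<exists>B. barrel_bounded E B \<and> {\<psi> \<in> dual E. dual_diff E \<psi> \<phi> \<in> polar E B} \<subseteq> W)"

definition beta_star :: "('k::{real_normed_field, euclidean_space}, 'a) tvs \<Rightarrow> ('a \<Rightarrow> 'k) topology"
  where "beta_star E = topology (beta_star_open E)"

lemma barrel_scale_mono:
  fixes E :: "('k::{real_normed_field, euclidean_space}, 'a) tvs"
  assumes E: "lcs E" and U: "barrel E U" and mn: "m \<le> (n::nat)"
  shows "scale_set E (of_nat m) U \<subseteq> scale_set E (of_nat n) U"
proof
  fix z assume "z \<in> scale_set E (of_nat m) U"
  then obtain u where u: "u \<in> U" and z: "z = of_nat m \<odot>\<^bsub>E\<^esub> u"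
    unfolding scale_set_def by blast
  interpret vectorspace scalars E using E unfolding lcs_def by blast
  have s: "carrier scalars = (UNIV :: 'k set)" "a \<otimes>\<^bsub>scalars\<^esub> b = a * b" "\<zero>\<^bsub>scalars\<^esub> = (0::'k)" for a b :: 'k
    by (simp_all add: ring_of_type_algebra_def)
  have uc: "u \<in> carrier E" using u U unfolding barrel_def abs_convex_in_def by blast
  show "z \<in> scale_set E (of_nat n) U"
  proof (cases "n = 0")
    case True
    then show ?thesis using mn z u unfolding scale_set_def by auto
  next
    case False
    define c :: 'k where "c = of_nat m / of_nat n"
    have c: "of_nat n * c = of_nat m" using False by (simp add: c_def)
    have "norm c \<le> 1" using False mn by (simp add: c_def norm_divide)
    then have "norm c + norm (0::'k) \<le> 1" by simp
    then have "c \<odot>\<^bsub>E\<^esub> u \<oplus>\<^bsub>E\<^esub> 0 \<odot>\<^bsub>E\<^esub> u \<in> U"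
      using U u unfolding barrel_def abs_convex_in_def by blast
    moreover have "0 \<odot>\<^bsub>E\<^esub> u = \<zero>\<^bsub>E\<^esub>" using smult_l_null[OF uc] s by simp
    moreover have "c \<odot>\<^bsub>E\<^esub> u \<in> carrier E" using uc s by simp
    ultimately have "c \<odot>\<^bsub>E\<^esub> u \<in> U" by simp
    moreover have "z = of_nat n \<odot>\<^bsub>E\<^esub> (c \<odot>\<^bsub>E\<^esub> u)"
      using smult_assoc1[of "of_nat n" c u] uc s z c by simp
    ultimately show ?thesis unfolding scale_set_def by blast
  qed
qed

lemma barrel_bounded_Un:
  assumes E: "lcs E" and A: "barrel_bounded E A" and B: "barrel_bounded E B"
  shows "barrel_bounded E (A \<union> B)"
proof -
  have "\<exists>n. A \<union> B \<subseteq> scale_set E (of_nat n) U" if U: "barrel E U" for U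
  proof -
    obtain m n where "A \<subseteq> scale_set E (of_nat m) U" "B \<subseteq> scale_set E (of_nat n) U"
      using A B U unfolding barrel_bounded_def by blast
    then have "A \<union> B \<subseteq> scale_set E (of_nat (max m n)) U"
      using barrel_scale_mono[OF E U, of m "max m n"] barrel_scale_mono[OF E U, of n "max m n"]
      by auto
    then show ?thesis by blast
  qed
  then show ?thesis using A B unfolding barrel_bounded_def by blast
qed

lemma openin_beta_star:
  assumes E: "lcs E"
  shows "openin (beta_star E) = beta_star_open E"
proof -
  have "istopology (beta_star_open E)"
    unfolding istopology_def
  proof (intro conjI allI impI)
    fix S T assume S: "beta_star_open E S" and T: "beta_star_open E T"
    show "beta_star_open E (S \<inter> T)"
      unfolding beta_star_open_def
    proof (intro conjI ballI)
      show "S \<inter> T \<subseteq> dual E" using S unfolding beta_star_open_def by blast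
      fix \<phi> assume "\<phi> \<in> S \<inter> T"
      then have \<phi>: "\<phi> \<in> S" "\<phi> \<in> T" by simp_all
      obtain A where A: "barrel_bounded E A" "{\<psi> \<in> dual E. dual_diff E \<psi> \<phi> \<in> polar E A} \<subseteq> S"
        using S \<phi>(1) unfolding beta_star_open_def by blast
      obtain B where B: "barrel_bounded E B" "{\<psi> \<in> dual E. dual_diff E \<psi> \<phi> \<in> polar E B} \<subseteq> T"
        using T \<phi>(2) unfolding beta_star_open_def by blast
      have "polar E (A \<union> B) \<subseteq> polar E A \<inter> polar E B" unfolding polar_def by blast
      then show "\<exists>B. barrel_bounded E B \<and> {\<psi> \<in> dual E. dual_diff E \<psi> \<phi> \<in> polar E B} \<subseteq> S \<inter> T"
        using A B barrel_bounded_Un[OF E A(1) B(1)] by (intro exI[of _ "A \<union> B"]) blast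
    qed
  next
    fix K assume K: "\<forall>S\<in>K. beta_star_open E S"
    show "beta_star_open E (\<Union>K)"
      unfolding beta_star_open_def
    proof (intro conjI ballI)
      show "\<Union>K \<subseteq> dual E" using K unfolding beta_star_open_def by blast
      fix \<phi> assume "\<phi> \<in> \<Union>K"
      then obtain S where S: "S \<in> K" "\<phi> \<in> S" by blast
      then obtain B where "barrel_bounded E B" "{\<psi> \<in> dual E. dual_diff E \<psi> \<phi> \<in> polar E B} \<subseteq> S"
        using K unfolding beta_star_open_def by blast
      then show "\<exists>B. barrel_bounded E B \<and> {\<psi> \<in> dual E. dual_diff E \<psi> \<phi> \<in> polar E B} \<subseteq> \<Union>K"
        using S(1) by blast
    qed
  qed
  then show ?thesis unfolding beta_star_def by (simp add: topology_inverse')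
qed

definition seq_continuous_map :: "'a topology \<Rightarrow> 'b topology \<Rightarrow> ('a \<Rightarrow> 'b) \<Rightarrow> bool"
  where "seq_continuous_map S T f \<longleftrightarrow> f \<in> topspace S \<rightarrow> topspace T \<and>
    (\<forall>s l. range s \<subseteq> topspace S \<and> limitin S s l sequentially
      \<longrightarrow> limitin T (\<lambda>n. f (s n)) (f l) sequentially)"

definition weak_star_null :: "('k::{real_normed_field, euclidean_space}, 'a) tvs \<Rightarrow> (nat \<Rightarrow> 'a \<Rightarrow> 'k) \<Rightarrow> bool"
  where "weak_star_null E \<phi> \<longleftrightarrow> range \<phi> \<subseteq> dual E \<and>
    limitin (weak_star E) \<phi> (\<lambda>x\<in>carrier E. 0) sequentially"

text \<open>Extended values, so that the supremum is meaningful for arbitrary \<open>B\<close>.\<close>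

definition sup_norm_on :: "('k::{real_normed_field, euclidean_space}, 'a) tvs \<Rightarrow> 'a set \<Rightarrow> ('a \<Rightarrow> 'k) \<Rightarrow> ennreal"
  where "sup_norm_on E B \<phi> = (SUP x\<in>B \<union> {\<zero>\<^bsub>E\<^esub>}. ennreal (norm (\<phi> x)))"


section \<open>Josefson--Nissenzweig and Gelfand--Phillips properties\<close>

definition JN_property :: "('k::{real_normed_field, euclidean_space}, 'a) tvs \<Rightarrow> bool"
  where "JN_property E \<longleftrightarrow> \<not> seq_continuous_map (weak_star E) (beta_star E) (\<lambda>\<phi>. \<phi>)"

definition strong_GP_property :: "('k::{real_normed_field, euclidean_space}, 'a) tvs \<Rightarrow> bool"
  where "strong_GP_property E \<longleftrightarrow> (\<exists>\<phi>. weak_star_null E \<phi> \<and>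
    (\<forall>B. barrel_bounded E B \<and> \<not> barrel_precompact E B
      \<longrightarrow> \<not> (\<lambda>n. sup_norm_on E B (\<phi> n)) \<longlonglongrightarrow> 0))"

definition limited :: "('k::{real_normed_field, euclidean_space}, 'a) tvs \<Rightarrow> 'a set \<Rightarrow> bool"
  where "limited E A \<longleftrightarrow> bounded_in E A \<and>
    (\<forall>\<phi>. weak_star_null E \<phi> \<longrightarrow> (\<lambda>n. sup_norm_on E A (\<phi> n)) \<longlonglongrightarrow> 0)"

definition GP_property :: "('k::{real_normed_field, euclidean_space}, 'a) tvs \<Rightarrow> bool"
  where "GP_property E \<longleftrightarrow> (\<forall>A. limited E A \<longrightarrow> barrel_precompact E A)"


section \<open>Operators\<close>

definition continuous_operator ::
    "('k::{real_normed_field, euclidean_space}, 'a) tvs \<Rightarrow> ('k, 'b) tvs \<Rightarrow> ('a \<Rightarrow> 'b) \<Rightarrow> bool"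
  where "continuous_operator E F T \<longleftrightarrow>
    T \<in> module_hom scalars E F \<and> continuous_map (vtop E) (vtop F) T"

definition beta_to_beta_precompact ::
    "('k::{real_normed_field, euclidean_space}, 'a) tvs \<Rightarrow> ('k, 'b) tvs \<Rightarrow> ('a \<Rightarrow> 'b) \<Rightarrow> bool"
  where "beta_to_beta_precompact E F T \<longleftrightarrow>
    (\<forall>B. barrel_bounded E B \<longrightarrow> barrel_precompact F (T ` B))"

definition Cp0 :: "('k::{real_normed_field, euclidean_space}, nat \<Rightarrow> 'k) tvs"
  where "Cp0 =
    \<lparr> carrier = {f. f \<longlonglongrightarrow> 0}, monoid.mult = (\<lambda>f g n. f n * g n), one = (\<lambda>n. 1),
      zero = (\<lambda>n. 0), add = (\<lambda>f g n. f n + g n), smult = (\<lambda>c f n. c * f n),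
      vtop = subtopology (product_topology (\<lambda>_. euclidean) UNIV) {f. f \<longlonglongrightarrow> 0} \<rparr>"

text \<open>
  ``For some locally convex space'' needs a type supporting the spaces. The universe below contains a
  copy of every space supported by the arbitrary type \<open>'u\<close>, and is large enough for \<^const>\<open>Cp0\<close>.
\<close>

type_synonym ('k, 'u) universe = "(nat \<Rightarrow> 'k) + 'u"


end

theory Submission
  imports Defs
begin

text \<open>
  The Josefson--Nissenzweig property says that some weak* null sequence \<open>\<phi>\<close> fails to tend to zero
  uniformly on some barrel-bounded set \<open>B\<close>. Then \<open>x \<mapsto> (\<phi> n x)\<^sub>n\<close> is a continuous operator into the null
  sequences; the sup-norm balls are barrels there, so barrel-precompactness of the image of \<open>B\<close> would
  force uniform convergence of \<open>\<phi>\<close> on \<open>B\<close>. Conversely, a weak* null sequence witnessing that the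
  image of a barrel-bounded set is not limited pulls back along the operator. The two Gelfand--Phillips
  properties of the null sequences are witnessed by the coordinate functionals: by the Baire category
  theorem every barrel contains a sup-norm ball, hence uniformly null bounded sets are barrel-precompact.
\<close>

section \<open>Locally convex spaces\<close>

text \<open>Sup-norm balls are barrels of the null sequences without being neighbourhoods of zero in
  the pointwise topology. Barrel-precompactness there is therefore much stronger than ordinary
  precompactness (the sup-norm unit ball has only the latter), and this strength is what detects
  uniform convergence. The price is paid in the other direction: a set has to be covered with
  respect to every barrel, so every barrel must be compared with a sup-norm ball. That comparison
  uses completeness of a second, finer topology on the same space.

  Pulling back works because preimages of barrels under an operator are barrels. One mismatch
  remains: limited sets are required to be bounded, while operators are tested on barrel-bounded
  sets. Barrel-bounded sets must hence be shown to be bounded, and this is where local convexity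
  enters.

  The existential statements range over spaces on one fixed type, so the null sequences are needed
  both as \<open>Cp0\<close> and inside the universe type.\<close>

locale lcs_space =
  fixes E :: "('k::{real_normed_field, euclidean_space}, 'a) tvs" (structure)
  assumes lcs: "lcs E"
begin

lemma vectorspace: "vectorspace scalars E"
  using lcs unfolding lcs_def by blast

lemma topspace_vtop: "topspace (vtop E) = carrier E"
  using lcs unfolding lcs_def by blast

lemma
  shows add_closed [simp]: "x \<in> carrier E \<Longrightarrow> y \<in> carrier E \<Longrightarrow> x \<oplus> y \<in> carrier E"
    and zero_closed [simp]: "\<zero> \<in> carrier E"
    and smult_closed [simp]: "x \<in> carrier E \<Longrightarrow> c \<odot> x \<in> carrier E"
    and smult_smult [simp]: "x \<in> carrier E \<Longrightarrow> c \<odot> (d \<odot> x) = (c * d) \<odot> x"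
    and smult_one [simp]: "x \<in> carrier E \<Longrightarrow> 1 \<odot> x = x"
    and smult_zero_left [simp]: "x \<in> carrier E \<Longrightarrow> 0 \<odot> x = \<zero>"
    and smult_zero_right [simp]: "c \<odot> \<zero> = \<zero>"
    and smult_add_right: "x \<in> carrier E \<Longrightarrow> y \<in> carrier E \<Longrightarrow> c \<odot> (x \<oplus> y) = c \<odot> x \<oplus> c \<odot> y"
    and smult_add_left: "x \<in> carrier E \<Longrightarrow> (c + d) \<odot> x = c \<odot> x \<oplus> d \<odot> x"
    and add_assoc: "x \<in> carrier E \<Longrightarrow> y \<in> carrier E \<Longrightarrow> z \<in> carrier E \<Longrightarrow> (x \<oplus> y) \<oplus> z = x \<oplus> (y \<oplus> z)"
    and add_zero_right [simp]: "x \<in> carrier E \<Longrightarrow> x \<oplus> \<zero> = x"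
    and add_zero_left [simp]: "x \<in> carrier E \<Longrightarrow> \<zero> \<oplus> x = x"
proof -
  interpret vectorspace scalars E by (rule vectorspace)
  have s: "carrier scalars = (UNIV :: 'k set)" "a \<otimes>\<^bsub>scalars\<^esub> b = a * b" "\<zero>\<^bsub>scalars\<^esub> = (0::'k)"
    "a \<oplus>\<^bsub>scalars\<^esub> b = a + b" "\<one>\<^bsub>scalars\<^esub> = (1::'k)" for a b :: 'k
    by (simp_all add: ring_of_type_algebra_def)
  note [simp] = s
  show "x \<oplus> y \<in> carrier E" if "x \<in> carrier E" "y \<in> carrier E" using that by simp
  show "\<zero> \<in> carrier E" by simp
  show "c \<odot> x \<in> carrier E" if "x \<in> carrier E" using that by simp
  show "c \<odot> (d \<odot> x) = (c * d) \<odot> x" if "x \<in> carrier E" using that smult_assoc1[of c d x] by simp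
  show "1 \<odot> x = x" if "x \<in> carrier E" using that smult_one[of x] by simp
  show "0 \<odot> x = \<zero>" if "x \<in> carrier E" using that smult_l_null[of x] by simp
  show "c \<odot> \<zero> = \<zero>" using smult_r_null[of c] by simp
  show "c \<odot> (x \<oplus> y) = c \<odot> x \<oplus> c \<odot> y" if "x \<in> carrier E" "y \<in> carrier E"
    using that smult_r_distr[of c x y] by simp
  show "(c + d) \<odot> x = c \<odot> x \<oplus> d \<odot> x" if "x \<in> carrier E"
    using that smult_l_distr[of c d x] by simp
  show "(x \<oplus> y) \<oplus> z = x \<oplus> (y \<oplus> z)" if "x \<in> carrier E" "y \<in> carrier E" "z \<in> carrier E"
    using that M.a_assoc by simp
  show "x \<oplus> \<zero> = x" "\<zero> \<oplus> x = x" if "x \<in> carrier E" using that by simp_all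
qed

lemma continuous_map_add:
  assumes "continuous_map S (vtop E) f" "continuous_map S (vtop E) g"
  shows "continuous_map S (vtop E) (\<lambda>x. f x \<oplus> g x)"
proof -
  have "continuous_map (prod_topology (vtop E) (vtop E)) (vtop E) (\<lambda>(x, y). x \<oplus> y)"
    using lcs unfolding lcs_def by blast
  then have "continuous_map S (vtop E) ((\<lambda>(x, y). x \<oplus> y) \<circ> (\<lambda>x. (f x, g x)))"
    using assms by (intro continuous_map_compose[of S "prod_topology (vtop E) (vtop E)"])
      (auto simp: continuous_map_paired)
  then show ?thesis by (simp add: o_def)
qed

lemma continuous_map_smult:
  assumes "continuous_map S euclidean f" "continuous_map S (vtop E) g"
  shows "continuous_map S (vtop E) (\<lambda>x. f x \<odot> g x)"
proof -
  have "continuous_map (prod_topology euclidean (vtop E)) (vtop E) (\<lambda>(c, x). c \<odot> x)"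
    using lcs unfolding lcs_def by blast
  then have "continuous_map S (vtop E) ((\<lambda>(c, x). c \<odot> x) \<circ> (\<lambda>x. (f x, g x)))"
    using assms by (intro continuous_map_compose[of S "prod_topology euclidean (vtop E)"])
      (auto simp: continuous_map_paired)
  then show ?thesis by (simp add: o_def)
qed

lemma mem_scale_set_iff:
  assumes "U \<subseteq> carrier E" "c \<noteq> 0"
  shows "x \<in> scale_set E c U \<longleftrightarrow> x \<in> carrier E \<and> inverse c \<odot> x \<in> U"
proof
  assume "x \<in> scale_set E c U"
  then obtain u where u: "u \<in> U" "x = c \<odot> u" unfolding scale_set_def by blast
  then have "u \<in> carrier E" using assms by blast
  then show "x \<in> carrier E \<and> inverse c \<odot> x \<in> U" using u assms by simp
next
  assume x: "x \<in> carrier E \<and> inverse c \<odot> x \<in> U"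
  then have "x = c \<odot> (inverse c \<odot> x)" using assms by simp
  then show "x \<in> scale_set E c U" using x unfolding scale_set_def by blast
qed

lemma abs_convex_smult:
  assumes U: "abs_convex_in E U" and x: "x \<in> U" and a: "norm a \<le> 1"
  shows "a \<odot> x \<in> U"
proof -
  have xc: "x \<in> carrier E" using U x unfolding abs_convex_in_def by blast
  have "norm a + norm (0::'k) \<le> 1" using a by simp
  then have "a \<odot> x \<oplus> 0 \<odot> x \<in> U" using U x unfolding abs_convex_in_def by blast
  then show ?thesis using xc by simp
qed

text \<open>For nonzero \<open>b\<close>, \<open>a \<odot> u\<close> is \<open>b\<close> times
  \<open>(a / b) \<odot> u\<close>, and \<open>a / b\<close> has modulus at most 1.\<close>

lemma abs_convex_scale_mono:
  assumes U: "abs_convex_in E U" and ab: "norm a \<le> norm b"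
  shows "scale_set E a U \<subseteq> scale_set E b U"
proof
  fix x assume "x \<in> scale_set E a U"
  then obtain u where u: "u \<in> U" "x = a \<odot> u" unfolding scale_set_def by blast
  have uc: "u \<in> carrier E" using U u unfolding abs_convex_in_def by blast
  show "x \<in> scale_set E b U"
  proof (cases "b = 0")
    case True
    then show ?thesis using u ab unfolding scale_set_def by auto
  next
    case False
    then have "norm (a / b) \<le> 1" using ab by (simp add: norm_divide)
    then have "(a / b) \<odot> u \<in> U" using abs_convex_smult[OF U u(1)] by blast
    moreover have "x = b \<odot> ((a / b) \<odot> u)" using u uc False by simp
    ultimately show ?thesis unfolding scale_set_def by blast
  qed
qed

text \<open>The factor \<open>c * of_nat n\<close> need not be a natural number, but for an
  absolutely convex set only its modulus matters, and some natural number exceeds that.\<close>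

lemma barrel_bounded_scale_set:
  assumes B: "barrel_bounded E B"
  shows "barrel_bounded E (scale_set E c B)"
  unfolding barrel_bounded_def
proof (intro conjI allI impI)
  show "scale_set E c B \<subseteq> carrier E" using B unfolding barrel_bounded_def scale_set_def by auto
  fix U assume U: "barrel E U"
  then have ac: "abs_convex_in E U" unfolding barrel_def by blast
  then have Uc: "U \<subseteq> carrier E" unfolding abs_convex_in_def by blast
  obtain n where n: "B \<subseteq> scale_set E (of_nat n) U" using B U unfolding barrel_bounded_def by blast
  obtain m where m: "norm c * n \<le> real m" using real_arch_simple by blast
  have "scale_set E c B \<subseteq> scale_set E (c * of_nat n) U"
    using n Uc unfolding scale_set_def by (force simp: image_iff)
  also have "\<dots> \<subseteq> scale_set E (of_nat m) U"
    using m by (intro abs_convex_scale_mono[OF ac]) (simp add: norm_mult)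
  finally show "\<exists>n. scale_set E c B \<subseteq> scale_set E (of_nat n) U" by blast
qed

section \<open>From convex neighbourhoods of zero to barrels\<close>

lemma openin_smult_nbhd:
  assumes G: "openin (vtop E) G" "\<zero> \<in> G"
  obtains \<delta> W where "\<delta> > 0" "openin (vtop E) W" "\<zero> \<in> W" "\<And>c x. norm c < \<delta> \<Longrightarrow> x \<in> W \<Longrightarrow> c \<odot> x \<in> G"
proof -
  let ?P = "prod_topology (euclidean :: 'k topology) (vtop E)"
  let ?S = "{p \<in> topspace ?P. fst p \<odot> snd p \<in> G}"
  have "continuous_map ?P (vtop E) (\<lambda>p. fst p \<odot> snd p)"
    by (intro continuous_map_smult continuous_map_fst continuous_map_snd)
  then have "openin ?P ?S" using G(1) by (rule openin_continuous_map_preimage)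
  moreover have "(0, \<zero>) \<in> ?S" using G(2) by (simp add: topspace_vtop)
  ultimately obtain A W where AW: "openin euclidean A" "openin (vtop E) W" "0 \<in> A" "\<zero> \<in> W" "A \<times> W \<subseteq> ?S"
    unfolding openin_prod_topology_alt by meson
  then obtain \<delta> where "\<delta> > 0" "ball 0 \<delta> \<subseteq> A" by (metis open_contains_ball open_openin)
  then show ?thesis using AW that[of \<delta> W] by (force simp: subset_iff)
qed

lemma nbhd0_absorbing:
  assumes U: "nbhd0 E U"
  shows "absorbing E U"
  unfolding absorbing_def
proof (intro conjI ballI)
  show Uc: "U \<subseteq> carrier E" using U unfolding nbhd0_def by blast
  obtain G where G: "openin (vtop E) G" "\<zero> \<in> G" "G \<subseteq> U" using U unfolding nbhd0_def by blast
  fix x assume x: "x \<in> carrier E"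
  have "continuous_map euclidean (vtop E) (\<lambda>c. c \<odot> x)"
    using x by (intro continuous_map_smult) (simp_all add: topspace_vtop)
  from openin_continuous_map_preimage[OF this G(1)] have "open {c. c \<odot> x \<in> G}"
    by simp
  moreover have "0 \<in> {c. c \<odot> x \<in> G}" using x G by simp
  ultimately obtain \<delta> where \<delta>: "\<delta> > 0" "ball 0 \<delta> \<subseteq> {c. c \<odot> x \<in> G}"
    by (meson open_contains_ball)
  \<comment> \<open>The 2 gives \<open>norm (inverse c) \<le> \<delta> / 2\<close>, strictly inside
    the open ball.\<close>
  have "{x} \<subseteq> scale_set E c U" if c: "norm c \<ge> 2 / \<delta>" for c
  proof -
    have "norm c > 0" using c \<delta>(1) by (auto intro: less_le_trans[of 0 "2 / \<delta>"])
    then have "norm (inverse c) < \<delta>" using c \<delta>(1)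
      by (auto simp: norm_inverse norm_divide field_simps)
    then have "inverse c \<odot> x \<in> U" using \<delta>(2) G(3) by auto
    then show ?thesis using mem_scale_set_iff[OF Uc, of c x] x \<open>norm c > 0\<close> by simp
  qed
  then show "absorbs E U {x}"
    using \<delta>(1) unfolding absorbs_def by (intro exI[of _ "2 / \<delta>"]) simp
qed

lemma absorbing_mono:
  assumes "absorbing E U" "U \<subseteq> V" "V \<subseteq> carrier E"
  shows "absorbing E V"
proof -
  have "scale_set E c U \<subseteq> scale_set E c V" for c using assms(2) unfolding scale_set_def by blast
  then show ?thesis using assms unfolding absorbing_def absorbs_def by (meson subset_trans)
qed

text \<open>The map taking a pair to its combination with coefficients \<open>a\<close>,
  \<open>b\<close> is continuous and sends \<open>D \<times> D\<close> into \<open>D\<close>; the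
  closure of the product is the product of the closures.\<close>

lemma abs_convex_closure:
  assumes D: "abs_convex_in E D"
  shows "abs_convex_in E ((vtop E) closure_of D)"
  unfolding abs_convex_in_def
proof (intro conjI ballI allI impI)
  show "(vtop E) closure_of D \<subseteq> carrier E" using closure_of_subset_topspace[of "vtop E" D] topspace_vtop by simp
  fix x y and a b :: 'k assume x: "x \<in> (vtop E) closure_of D" and y: "y \<in> (vtop E) closure_of D"
    and ab: "norm a + norm b \<le> 1"
  let ?P = "prod_topology (vtop E) (vtop E)" and ?f = "\<lambda>p. a \<odot> fst p \<oplus> b \<odot> snd p"
  have "continuous_map ?P (vtop E) ?f"
    by (intro continuous_map_add continuous_map_smult continuous_map_fst continuous_map_snd) simp_all
  then have "?f ` (?P closure_of (D \<times> D)) \<subseteq> (vtop E) closure_of (?f ` (D \<times> D))"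
    by (rule continuous_map_image_closure_subset)
  also have "\<dots> \<subseteq> (vtop E) closure_of D"
    using D ab unfolding abs_convex_in_def by (intro closure_of_mono) auto
  finally have "?f (x, y) \<in> (vtop E) closure_of D"
    using x y closure_of_Times[of "vtop E" "vtop E" D D] by blast
  then show "a \<odot> x \<oplus> b \<odot> y \<in> (vtop E) closure_of D" by simp
qed

text \<open>This is the balanced core of \<open>V\<close>. With \<open>s = norm a + norm b\<close>,
  the combination with coefficients \<open>c * a\<close>, \<open>c * b\<close> is a convex
  combination with weights \<open>norm a / s\<close> and \<open>norm b / s\<close> of multiples of
  \<open>x\<close> and \<open>y\<close> by scalars of modulus
  \<open>norm c * s \<le> 1\<close>.\<close>

lemma abs_convex_core:
  assumes V: "convex_in E V"
  shows "abs_convex_in E {x \<in> carrier E. \<forall>c. norm c \<le> 1 \<longrightarrow> c \<odot> x \<in> V}" (is "abs_convex_in E ?D")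
  unfolding abs_convex_in_def
proof (intro conjI ballI allI impI)
  show "?D \<subseteq> carrier E" by blast
  fix x y and a b :: 'k assume x: "x \<in> ?D" and y: "y \<in> ?D" and ab: "norm a + norm b \<le> 1"
  have xy: "x \<in> carrier E" "y \<in> carrier E" using x y by blast+
  have "c \<odot> (a \<odot> x \<oplus> b \<odot> y) \<in> V" if c: "norm c \<le> 1" for c
  \<comment> \<open>The rescaled coefficients divide by \<open>norm a\<close> and
    \<open>norm b\<close>, so vanishing coefficients are treated apart.\<close>
  proof (cases "a = 0 \<or> b = 0")
    case True
    have "norm a \<le> 1" "norm b \<le> 1" using ab norm_ge_zero[of a] norm_ge_zero[of b] by linarith+
    then have "norm (c * a) \<le> 1" "norm (c * b) \<le> 1"
      using c by (simp_all add: norm_mult mult_le_one)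
    then have "(c * a) \<odot> x \<in> V" "(c * b) \<odot> y \<in> V" using x y by blast+
    then show ?thesis using True xy by (auto simp: smult_add_right)
  next
    case False
    define s where "s = norm a + norm b"
    have s: "0 < s" "s \<le> 1" using False ab by (auto simp: s_def add_pos_nonneg)
    define t where "t = norm b / s"
    have t: "0 < t" "1 - t = norm a / s" "1 - t > 0" using False s
      by (auto simp: t_def s_def field_simps)
    define p where "p = c * a * of_real (s / norm a)"
    define q where "q = c * b * of_real (s / norm b)"
    have "norm p = norm c * s" "norm q = norm c * s"
      using False s by (auto simp: p_def q_def norm_mult norm_divide)
    then have "norm p \<le> 1" "norm q \<le> 1" using c s by (auto intro!: mult_le_one)
    then have "p \<odot> x \<in> V" "q \<odot> y \<in> V" using x y by blast+
    then have "of_real (1 - t) \<odot> (p \<odot> x) \<oplus> of_real t \<odot> (q \<odot> y) \<in> V"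
      using V t(1,3) unfolding convex_in_def by (meson atLeastAtMost_iff diff_gt_0_iff_gt less_imp_le)
    moreover have "of_real (1 - t) * p = c * a" "of_real t * q = c * b"
      using False s(1) unfolding t(2) by (auto simp: p_def q_def t_def)
    ultimately show ?thesis using xy by (simp add: smult_add_right)
  qed
  then show "a \<odot> x \<oplus> b \<odot> y \<in> ?D" using xy by simp
qed

text \<open>A point \<open>x\<close> of the closure has some \<open>y \<in> D\<close> with
  \<open>y - x \<in> D\<close>, and half of \<open>x\<close> is half of \<open>y\<close> minus half
  of \<open>y - x\<close>.\<close>

lemma closure_of_subset_double:
  assumes D: "abs_convex_in E D" "nbhd0 E D"
  shows "(vtop E) closure_of D \<subseteq> scale_set E 2 D"
proof
  fix x assume x: "x \<in> (vtop E) closure_of D"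
  have Dc: "D \<subseteq> carrier E" using D(1) unfolding abs_convex_in_def by blast
  have xc: "x \<in> carrier E" using x closure_of_subset_topspace[of "vtop E" D] topspace_vtop by auto
  obtain G where G: "openin (vtop E) G" "\<zero> \<in> G" "G \<subseteq> D" using D(2) unfolding nbhd0_def by blast
  let ?N = "{y \<in> topspace (vtop E). y \<oplus> (-1) \<odot> x \<in> G}"
  have "continuous_map (vtop E) (vtop E) (\<lambda>y. y \<oplus> (-1) \<odot> x)"
    using xc by (intro continuous_map_add) (simp_all add: topspace_vtop)
  then have "openin (vtop E) ?N" using G(1) by (rule openin_continuous_map_preimage)
  moreover have "x \<oplus> (-1) \<odot> x = \<zero>" using smult_add_left[OF xc, of 1 "-1"] xc by simp
  then have "x \<in> ?N" using xc G(2) by (simp add: topspace_vtop)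
  ultimately obtain y where "y \<in> D" "y \<in> ?N"
    using x unfolding in_closure_of by meson
  then have y: "y \<in> D" "y \<oplus> (-1) \<odot> x \<in> D" using G(3) by auto
  have yc: "y \<in> carrier E" using y Dc by blast
  have "norm (1/2 :: 'k) + norm (- 1/2 :: 'k) \<le> 1" by (simp add: norm_divide)
  then have "(1/2) \<odot> y \<oplus> (- 1/2) \<odot> (y \<oplus> (-1) \<odot> x) \<in> D"
    using D(1) y unfolding abs_convex_in_def by blast
  also have "(1/2) \<odot> y \<oplus> (- 1/2) \<odot> (y \<oplus> (-1) \<odot> x) = ((1/2) \<odot> y \<oplus> (- 1/2) \<odot> y) \<oplus> (1/2) \<odot> x"
    using xc yc by (simp add: smult_add_right add_assoc)
  also have "(1/2) \<odot> y \<oplus> (- 1/2) \<odot> y = \<zero>"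
    using smult_add_left[OF yc, of "1/2" "- 1/2"] yc by simp
  finally have "\<zero> \<oplus> (1/2) \<odot> x \<in> D" .
  then have "inverse 2 \<odot> x \<in> D" using xc by (simp add: inverse_eq_divide)
  then show "x \<in> scale_set E 2 D" using mem_scale_set_iff[OF Dc, of 2 x] xc by simp
qed

text \<open>Spaces are only assumed to have convex neighbourhoods of zero, while barrels are closed and
  absolutely convex.\<close>

lemma nbhd0_barrel:
  assumes U: "nbhd0 E U"
  obtains D W where "abs_convex_in E D" "D \<subseteq> U" "barrel E W" "W \<subseteq> scale_set E 2 D"
proof -
  obtain V where V: "nbhd0 E V" "convex_in E V" "V \<subseteq> U" using lcs U unfolding lcs_def by blast
  define D where "D = {x \<in> carrier E. \<forall>c. norm c \<le> 1 \<longrightarrow> c \<odot> x \<in> V}"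
  have D: "abs_convex_in E D" unfolding D_def using V(2) by (rule abs_convex_core)
  have DV: "D \<subseteq> V" unfolding D_def by (auto dest: spec[of _ 1])
  obtain G where G: "openin (vtop E) G" "\<zero> \<in> G" "G \<subseteq> V" using V(1) unfolding nbhd0_def by blast
  obtain \<delta> W where W: "\<delta> > 0" "openin (vtop E) W" "\<zero> \<in> W" "\<And>c x. norm c < \<delta> \<Longrightarrow> x \<in> W \<Longrightarrow> c \<odot> x \<in> G"
    using openin_smult_nbhd[OF G(1,2)] by metis
  \<comment> \<open>For \<open>norm c \<le> 1\<close>, \<open>c \<odot> x\<close> is
    \<open>c * \<delta> / 2\<close> times the point \<open>2 / \<delta>\<close> times
    \<open>x\<close> of \<open>W\<close>, and the first factor has modulus below
    \<open>\<delta>\<close>. So the core \<open>D\<close> of \<open>V\<close> still contains a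
    neighbourhood of zero.\<close>
  define W' where "W' = {x \<in> topspace (vtop E). of_real (2 / \<delta>) \<odot> x \<in> W}"
  have "openin (vtop E) W'" unfolding W'_def
    by (intro openin_continuous_map_preimage[OF _ W(2)] continuous_map_smult) simp_all
  moreover have "\<zero> \<in> W'" using W(3) by (simp add: W'_def topspace_vtop)
  moreover have "W' \<subseteq> D"
  proof
    fix x assume x: "x \<in> W'"
    then have xc: "x \<in> carrier E" by (simp add: W'_def topspace_vtop)
    have "c \<odot> x \<in> V" if c: "norm c \<le> 1" for c
    proof -
      have "norm c * \<delta> \<le> 1 * \<delta>" using c W(1) by (intro mult_right_mono) simp_all
      then have "norm (c * of_real (\<delta> / 2)) < \<delta>" using W(1) by (simp add: norm_mult norm_divide)
      then have "(c * of_real (\<delta> / 2)) \<odot> (of_real (2 / \<delta>) \<odot> x) \<in> G"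
        using x W(4) by (simp add: W'_def)
      then show ?thesis using G(3) xc W(1) by auto
    qed
    then show "x \<in> D" using xc by (simp add: D_def)
  qed
  ultimately have D0: "nbhd0 E D" using D unfolding nbhd0_def abs_convex_in_def by blast
  have "D \<subseteq> (vtop E) closure_of D"
    using D topspace_vtop unfolding abs_convex_in_def by (simp add: closure_of_subset)
  then have "barrel E ((vtop E) closure_of D)"
    unfolding barrel_def
    using abs_convex_closure[OF D] absorbing_mono[OF nbhd0_absorbing[OF D0]]
    unfolding abs_convex_in_def by simp
  from this closure_of_subset_double[OF D D0] show ?thesis
    by (rule that[OF D subset_trans[OF DV V(3)]])
qed

text \<open>A neighbourhood need not contain the closure of its core \<open>D\<close>, but that
  closure is a barrel inside \<open>2 D\<close>, which costs only a factor 2 in the absorption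
  radius.\<close>

lemma barrel_bounded_imp_bounded:
  assumes B: "barrel_bounded E B"
  shows "bounded_in E B"
  unfolding bounded_in_def
proof (intro conjI allI impI)
  show "B \<subseteq> carrier E" using B unfolding barrel_bounded_def by blast
  fix U assume "nbhd0 E U"
  then obtain D W where D: "abs_convex_in E D" "D \<subseteq> U" "barrel E W" "W \<subseteq> scale_set E 2 D"
    by (rule nbhd0_barrel)
  have Dc: "D \<subseteq> carrier E" using D(1) unfolding abs_convex_in_def by blast
  obtain n where n: "B \<subseteq> scale_set E (of_nat n) W" using B D(3) unfolding barrel_bounded_def by blast
  \<comment> \<open>The added 1 keeps the radius positive when \<open>n = 0\<close>.\<close>
  have "B \<subseteq> scale_set E c U" if c: "norm c \<ge> 2 * real n + 1" for c
  proof -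
    have "B \<subseteq> scale_set E (of_nat n) (scale_set E 2 D)"
      using n D(4) unfolding scale_set_def by blast
    also have "\<dots> \<subseteq> scale_set E (of_nat n * 2) D"
      using Dc unfolding scale_set_def by (force simp: image_iff)
    also have "\<dots> \<subseteq> scale_set E c D"
      using c by (intro abs_convex_scale_mono[OF D(1)]) (simp add: norm_mult)
    also have "\<dots> \<subseteq> scale_set E c U" using D(2) unfolding scale_set_def by blast
    finally show ?thesis .
  qed
  then show "absorbs E U B"
    unfolding absorbs_def by (intro exI[of _ "2 * real n + 1"]) (simp add: add_nonneg_pos)
qed

end

section \<open>Functionals, uniform convergence and the two dual topologies\<close>

lemma dualD:
  assumes "\<phi> \<in> dual E"
  shows "x \<in> carrier E \<Longrightarrow> y \<in> carrier E \<Longrightarrow> \<phi> (x \<oplus>\<^bsub>E\<^esub> y) = \<phi> x + \<phi> y"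
    and "x \<in> carrier E \<Longrightarrow> \<phi> (c \<odot>\<^bsub>E\<^esub> x) = c * \<phi> x"
    and "continuous_map (vtop E) euclidean \<phi>"
    and "\<phi> \<in> extensional (carrier E)"
  using assms unfolding dual_def by blast+

text \<open>Real thresholds suffice: by density some finite positive value lies below any given
  positive bound.\<close>

lemma ennreal_tendsto_0_iff:
  fixes f :: "'a \<Rightarrow> ennreal"
  shows "(f \<longlongrightarrow> 0) F \<longleftrightarrow> (\<forall>e>0. eventually (\<lambda>n. f n \<le> ennreal e) F)"
proof
  assume L: "(f \<longlongrightarrow> 0) F"
  show "\<forall>e>0. eventually (\<lambda>n. f n \<le> ennreal e) F"
  proof (intro allI impI)
    fix e :: real assume "e > 0"
    then have "eventually (\<lambda>n. f n < ennreal e) F" by (intro order_tendstoD(2)[OF L]) simp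
    then show "eventually (\<lambda>n. f n \<le> ennreal e) F" by eventually_elim simp
  qed
next
  assume R: "\<forall>e>0. eventually (\<lambda>n. f n \<le> ennreal e) F"
  show "(f \<longlongrightarrow> 0) F"
  proof (rule order_tendstoI)
    fix a :: ennreal assume "0 < a"
    then obtain b where b: "0 < b" "b < a" using dense by blast
    then obtain r where r: "b = ennreal r" "r > 0"
      by (cases b) (auto simp: ennreal_less_zero_iff)
    then have "eventually (\<lambda>n. f n \<le> b) F" using R by simp
    then show "eventually (\<lambda>n. f n < a) F" by eventually_elim (use b(2) in simp)
  qed simp
qed

context lcs_space
begin

lemma dual_zero: "\<phi> \<in> dual E \<Longrightarrow> \<phi> \<zero> = 0"
  using dualD(2)[of \<phi> E "\<zero>" 0] by simp

lemma sup_norm_on_le_iff: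
  assumes "\<phi> \<in> dual E" "e \<ge> 0"
  shows "sup_norm_on E B \<phi> \<le> ennreal e \<longleftrightarrow> (\<forall>x\<in>B. norm (\<phi> x) \<le> e)"
  using assms dual_zero unfolding sup_norm_on_def by (force simp: SUP_le_iff)

lemma zero_mem_dual: "(\<lambda>x\<in>carrier E. 0) \<in> dual E"
proof -
  have "continuous_map (vtop E) euclidean (\<lambda>x\<in>carrier E. 0 :: 'k)"
    by (rule continuous_map_eq[of _ _ "\<lambda>_. 0"]) (simp_all add: topspace_vtop)
  then show ?thesis by (simp add: dual_def)
qed

lemma dual_diff_mem_dual:
  assumes "\<psi> \<in> dual E" "\<phi> \<in> dual E"
  shows "dual_diff E \<psi> \<phi> \<in> dual E"
proof -
  have "continuous_map (vtop E) euclidean (\<lambda>x. \<psi> x - \<phi> x)"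
    using assms by (intro continuous_map_diff dualD(3))
  then have "continuous_map (vtop E) euclidean (dual_diff E \<psi> \<phi>)"
    by (rule continuous_map_eq) (simp add: topspace_vtop dual_diff_def)
  then show ?thesis
    using assms by (simp add: dual_def dual_diff_def algebra_simps)
qed

lemma topspace_weak_star: "topspace (weak_star E) = dual E"
  unfolding weak_star_def by (auto simp: PiE_def dualD(4))

lemma topspace_beta_star: "topspace (beta_star E) = dual E"
proof
  show "topspace (beta_star E) \<subseteq> dual E"
    unfolding topspace_def openin_beta_star[OF lcs] beta_star_open_def by blast
  \<comment> \<open>Openness of the whole dual needs just one barrel-bounded set as a
    witness.\<close>
  have "barrel_bounded E {}" unfolding barrel_bounded_def by simp
  then have "openin (beta_star E) (dual E)"
    unfolding openin_beta_star[OF lcs] beta_star_open_def by blast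
  then show "dual E \<subseteq> topspace (beta_star E)" by (rule openin_subset)
qed

lemma limitin_weak_star_iff:
  "limitin (weak_star E) \<phi> l sequentially \<longleftrightarrow>
    l \<in> dual E \<and> (\<forall>\<^sub>F n in sequentially. \<phi> n \<in> dual E) \<and> (\<forall>x\<in>carrier E. (\<lambda>n. \<phi> n x) \<longlonglongrightarrow> l x)"
  unfolding weak_star_def limitin_subtopology limitin_componentwise
  by (auto simp: PiE_def dualD(4) elim: eventually_mono)

lemma weak_star_null_iff:
  "weak_star_null E \<phi> \<longleftrightarrow> (\<forall>n. \<phi> n \<in> dual E) \<and> (\<forall>x\<in>carrier E. (\<lambda>n. \<phi> n x) \<longlonglongrightarrow> 0)"
  unfolding weak_star_null_def limitin_weak_star_iff using zero_mem_dual
  by (auto simp: image_subset_iff)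

lemma sup_norm_on_tendsto_0_iff:
  assumes "\<And>n. \<phi> n \<in> dual E"
  shows "(\<lambda>n. sup_norm_on E B (\<phi> n)) \<longlonglongrightarrow> 0 \<longleftrightarrow>
    (\<forall>e>0. eventually (\<lambda>n. \<forall>x\<in>B. norm (\<phi> n x) \<le> e) sequentially)"
  unfolding ennreal_tendsto_0_iff using assms by (simp add: sup_norm_on_le_iff)

text \<open>The uniform bound is kept strictly below \<open>e\<close>, which leaves room for a multiple of \<open>B\<close> whose
  polar gives a neighbourhood.\<close>

lemma openin_beta_star_uniform_ball:
  assumes B: "barrel_bounded E B"
  shows "openin (beta_star E) {\<psi> \<in> dual E. \<exists>s<e. \<forall>x\<in>B. norm (\<psi> x) \<le> s}" (is "openin _ ?W")
  unfolding openin_beta_star[OF lcs] beta_star_open_def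
proof (intro conjI ballI)
  show "?W \<subseteq> dual E" by blast
  fix \<phi> assume "\<phi> \<in> ?W"
  then obtain s where s: "s < e" "\<And>x. x \<in> B \<Longrightarrow> norm (\<phi> x) \<le> s" "\<phi> \<in> dual E" by blast
  define \<delta> where "\<delta> = (e - s) / 2"
  have \<delta>: "\<delta> > 0" "s + \<delta> < e" using s(1) by (simp_all add: \<delta>_def field_simps)
  have "\<psi> \<in> ?W"
    if \<psi>: "\<psi> \<in> dual E" "dual_diff E \<psi> \<phi> \<in> polar E (scale_set E (of_real (1 / \<delta>)) B)" for \<psi>
  proof -
    have "norm (\<psi> x) \<le> s + \<delta>" if x: "x \<in> B" for x
    proof -
      have xc: "x \<in> carrier E" using x B unfolding barrel_bounded_def by blast
      have "norm (dual_diff E \<psi> \<phi> (of_real (1 / \<delta>) \<odot> x)) \<le> 1"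
        using \<psi>(2) x unfolding polar_def scale_set_def by blast
      then have "norm (of_real (1 / \<delta>) * (\<psi> x - \<phi> x)) \<le> 1"
        using dualD(2)[OF \<psi>(1) xc] dualD(2)[OF s(3) xc] xc
        by (simp add: dual_diff_def algebra_simps)
      then have "norm (\<psi> x - \<phi> x) \<le> \<delta>"
        using \<delta>(1) by (simp add: norm_mult norm_divide field_simps)
      then show ?thesis using s(2)[OF x] norm_triangle_sub[of "\<psi> x" "\<phi> x"] by linarith
    qed
    then show ?thesis using \<psi>(1) \<delta>(2) by blast
  qed
  then show "\<exists>B. barrel_bounded E B \<and> {\<psi> \<in> dual E. dual_diff E \<psi> \<phi> \<in> polar E B} \<subseteq> ?W"
    using barrel_bounded_scale_set[OF B] by blast
qed

text \<open>Polars of barrel-bounded sets describe uniform convergence on such sets, so the topology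
  \<open>beta_star\<close> can be eliminated. A failure of convergence at an arbitrary limit is
  translated to zero.\<close>

lemma JN_property_iff:
  "JN_property E \<longleftrightarrow> (\<exists>\<phi> B. weak_star_null E \<phi> \<and> barrel_bounded E B \<and>
    \<not> (\<lambda>n. sup_norm_on E B (\<phi> n)) \<longlonglongrightarrow> 0)"
proof
  assume "JN_property E"
  \<comment> \<open>Both topologies live on \<open>dual E\<close>, so the identity maps one space
    into the other and only the preservation of limits can fail.\<close>
  then obtain s l where s: "range s \<subseteq> dual E" "limitin (weak_star E) s l sequentially"
      "\<not> limitin (beta_star E) s l sequentially"
    unfolding JN_property_def seq_continuous_map_def topspace_weak_star topspace_beta_star by auto
  have sd: "s n \<in> dual E" for n using s(1) by blast
  have l: "l \<in> dual E" "\<And>x. x \<in> carrier E \<Longrightarrow> (\<lambda>n. s n x) \<longlonglongrightarrow> l x"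
    using s(2) unfolding limitin_weak_star_iff by blast+
  obtain W where W: "openin (beta_star E) W" "l \<in> W" "\<not> (\<forall>\<^sub>F n in sequentially. s n \<in> W)"
    using s(3) l(1) unfolding limitin_def topspace_beta_star by blast
  obtain B where B: "barrel_bounded E B" "{\<psi> \<in> dual E. dual_diff E \<psi> l \<in> polar E B} \<subseteq> W"
    using W(1,2) unfolding openin_beta_star[OF lcs] beta_star_open_def by blast
  define \<phi> where "\<phi> n = dual_diff E (s n) l" for n
  have \<phi>d: "\<phi> n \<in> dual E" for n unfolding \<phi>_def using sd l(1) by (rule dual_diff_mem_dual)
  have "(\<lambda>n. \<phi> n x) \<longlonglongrightarrow> 0" if "x \<in> carrier E" for x
    using LIM_zero[OF l(2)[OF that]] that by (simp add: \<phi>_def dual_diff_def)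
  then have "weak_star_null E \<phi>" using \<phi>d unfolding weak_star_null_iff by blast
  moreover have "\<not> (\<lambda>n. sup_norm_on E B (\<phi> n)) \<longlonglongrightarrow> 0"
  proof
    assume "(\<lambda>n. sup_norm_on E B (\<phi> n)) \<longlonglongrightarrow> 0"
    \<comment> \<open>The bound 1 is the one in the definition of the polar, so it puts
      \<open>s n\<close> into \<open>W\<close>.\<close>
    then have "\<forall>\<^sub>F n in sequentially. \<forall>x\<in>B. norm (\<phi> n x) \<le> 1"
      unfolding sup_norm_on_tendsto_0_iff[OF \<phi>d] by simp
    then have "\<forall>\<^sub>F n in sequentially. s n \<in> W"
      by eventually_elim (use B(2) sd \<phi>d in \<open>auto simp: polar_def \<phi>_def\<close>)
    then show False using W(3) by blast
  qed
  ultimately show "\<exists>\<phi> B. weak_star_null E \<phi> \<and> barrel_bounded E B \<and>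
      \<not> (\<lambda>n. sup_norm_on E B (\<phi> n)) \<longlonglongrightarrow> 0"
    using B(1) by blast
next
  assume "\<exists>\<phi> B. weak_star_null E \<phi> \<and> barrel_bounded E B \<and>
      \<not> (\<lambda>n. sup_norm_on E B (\<phi> n)) \<longlonglongrightarrow> 0"
  then obtain \<phi> B where \<phi>: "weak_star_null E \<phi>" and B: "barrel_bounded E B"
    and n0: "\<not> (\<lambda>n. sup_norm_on E B (\<phi> n)) \<longlonglongrightarrow> 0" by blast
  have \<phi>d: "\<phi> n \<in> dual E" for n using \<phi> unfolding weak_star_null_iff by blast
  let ?z = "\<lambda>x\<in>carrier E. 0"
  obtain e where e: "e > 0" "\<not> (\<forall>\<^sub>F n in sequentially. \<forall>x\<in>B. norm (\<phi> n x) \<le> e)"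
    using n0 unfolding sup_norm_on_tendsto_0_iff[OF \<phi>d] by blast
  let ?W = "{\<psi> \<in> dual E. \<exists>s<e. \<forall>x\<in>B. norm (\<psi> x) \<le> s}"
  have "\<not> limitin (beta_star E) \<phi> ?z sequentially"
  proof
    assume L: "limitin (beta_star E) \<phi> ?z sequentially"
    have "?z \<in> ?W"
      using e(1) zero_mem_dual B unfolding barrel_bounded_def by (auto intro!: exI[of _ 0])
    then have "\<forall>\<^sub>F n in sequentially. \<phi> n \<in> ?W"
      using L openin_beta_star_uniform_ball[OF B] unfolding limitin_def by blast
    then have "\<forall>\<^sub>F n in sequentially. \<forall>x\<in>B. norm (\<phi> n x) \<le> e"
      by eventually_elim force
    then show False using e(2) by blast
  qed
  then have "\<not> seq_continuous_map (weak_star E) (beta_star E) (\<lambda>\<phi>. \<phi>)"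
    using \<phi> unfolding weak_star_null_def seq_continuous_map_def topspace_weak_star by blast
  then show "JN_property E" unfolding JN_property_def .
qed

end

section \<open>Operators and the pullback of weak* null sequences\<close>

locale lcs_operator = dom: lcs_space E + cod: lcs_space Y
  for E :: "('k::{real_normed_field, euclidean_space}, 'a) tvs"
    and Y :: "('k, 'b) tvs" +
  fixes T :: "'a \<Rightarrow> 'b"
  assumes op: "continuous_operator E Y T"
begin

lemma
  shows op_closed: "x \<in> carrier E \<Longrightarrow> T x \<in> carrier Y"
    and op_add: "x \<in> carrier E \<Longrightarrow> y \<in> carrier E \<Longrightarrow> T (x \<oplus>\<^bsub>E\<^esub> y) = T x \<oplus>\<^bsub>Y\<^esub> T y"
    and op_smult: "x \<in> carrier E \<Longrightarrow> T (c \<odot>\<^bsub>E\<^esub> x) = c \<odot>\<^bsub>Y\<^esub> T x"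
    and op_continuous: "continuous_map (vtop E) (vtop Y) T"
  using op unfolding continuous_operator_def module_hom_def
  by (auto simp: ring_of_type_algebra_def)

text \<open>Continuity gives closedness, linearity the rest. This makes images of barrel-bounded
  sets barrel-bounded.\<close>

lemma barrel_vimage:
  assumes U: "barrel Y U"
  shows "barrel E {x \<in> carrier E. T x \<in> U}" (is "barrel E ?V")
  unfolding barrel_def
proof (intro conjI)
  have U': "closedin (vtop Y) U" "abs_convex_in Y U" "absorbing Y U" "U \<subseteq> carrier Y"
    using U unfolding barrel_def abs_convex_in_def by blast+
  show "closedin (vtop E) ?V"
    using closedin_continuous_map_preimage[OF op_continuous U'(1)] by (simp add: dom.topspace_vtop)
  show "abs_convex_in E ?V"
    using U'(2) unfolding abs_convex_in_def by (auto simp: op_add op_smult)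
  have "absorbs E ?V {x}" if x: "x \<in> carrier E" for x
  proof -
    obtain r where r: "r > 0" "\<And>c. norm c \<ge> r \<Longrightarrow> {T x} \<subseteq> scale_set Y c U"
      using U'(3) op_closed[OF x] unfolding absorbing_def absorbs_def by metis
    have "{x} \<subseteq> scale_set E c ?V" if c: "norm c \<ge> r" for c
    proof -
      have "c \<noteq> 0" using c r(1) by auto
      then have "inverse c \<odot>\<^bsub>Y\<^esub> T x \<in> U"
        using r(2)[OF c] cod.mem_scale_set_iff[OF U'(4), of c "T x"] by simp
      then have "inverse c \<odot>\<^bsub>E\<^esub> x \<in> ?V" using x by (simp add: op_smult)
      then show ?thesis using dom.mem_scale_set_iff[of ?V c x] \<open>c \<noteq> 0\<close> x by simp
    qed
    then show ?thesis using r(1) unfolding absorbs_def by blast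
  qed
  then show "absorbing E ?V" unfolding absorbing_def by blast
qed

lemma barrel_bounded_image:
  assumes B: "barrel_bounded E B"
  shows "barrel_bounded Y (T ` B)"
  unfolding barrel_bounded_def
proof (intro conjI allI impI)
  have Bc: "B \<subseteq> carrier E" using B unfolding barrel_bounded_def by blast
  then show "T ` B \<subseteq> carrier Y" using op_closed by blast
  fix U assume "barrel Y U"
  then obtain n where n: "B \<subseteq> scale_set E (of_nat n) {x \<in> carrier E. T x \<in> U}"
    using B barrel_vimage unfolding barrel_bounded_def by blast
  have "T ` B \<subseteq> scale_set Y (of_nat n) U"
  proof
    fix y assume "y \<in> T ` B"
    then obtain x where "x \<in> B" "y = T x" by blast
    then obtain u where "u \<in> carrier E" "T u \<in> U" "y = T (of_nat n \<odot>\<^bsub>E\<^esub> u)"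
      using n unfolding scale_set_def by blast
    then show "y \<in> scale_set Y (of_nat n) U" unfolding scale_set_def by (auto simp: op_smult)
  qed
  then show "\<exists>n. T ` B \<subseteq> scale_set Y (of_nat n) U" by blast
qed

lemma comp_mem_dual:
  assumes "\<phi> \<in> dual Y"
  shows "(\<lambda>x\<in>carrier E. \<phi> (T x)) \<in> dual E"
proof -
  have "continuous_map (vtop E) euclidean (\<phi> \<circ> T)"
    using op_continuous dualD(3)[OF assms] by (rule continuous_map_compose)
  then have "continuous_map (vtop E) euclidean (\<lambda>x\<in>carrier E. \<phi> (T x))"
    by (rule continuous_map_eq) (simp add: dom.topspace_vtop)
  then show ?thesis
    using dualD(1,2)[OF assms] by (simp add: dual_def op_add op_smult op_closed)
qed

text \<open>Composed with \<open>T\<close>, the functional \<open>\<phi> n\<close> takes on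
  \<open>B\<close> exactly the values that \<open>\<phi> n\<close> takes on the image of
  \<open>B\<close>, so the failure of uniform convergence carries over.\<close>

lemma JN_property_pullback:
  assumes \<phi>: "weak_star_null Y \<phi>" and B: "barrel_bounded E B"
    and n0: "\<not> (\<lambda>n. sup_norm_on Y (T ` B) (\<phi> n)) \<longlonglongrightarrow> 0"
  shows "JN_property E"
proof -
  have \<phi>d: "\<phi> n \<in> dual Y" for n using \<phi> unfolding cod.weak_star_null_iff by blast
  have Bc: "x \<in> carrier E" if "x \<in> B" for x using B that unfolding barrel_bounded_def by blast
  define \<psi> where "\<psi> n = (\<lambda>x\<in>carrier E. \<phi> n (T x))" for n
  have \<psi>d: "\<psi> n \<in> dual E" for n unfolding \<psi>_def using \<phi>d by (rule comp_mem_dual)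
  have "weak_star_null E \<psi>"
    using \<phi> \<psi>d unfolding dom.weak_star_null_iff cod.weak_star_null_iff
    by (simp add: \<psi>_def op_closed)
  moreover have "\<not> (\<lambda>n. sup_norm_on E B (\<psi> n)) \<longlonglongrightarrow> 0"
    using n0 unfolding dom.sup_norm_on_tendsto_0_iff[OF \<psi>d] cod.sup_norm_on_tendsto_0_iff[OF \<phi>d]
    by (simp add: \<psi>_def Bc)
  ultimately show ?thesis using B unfolding dom.JN_property_iff by blast
qed

text \<open>The image of \<open>B\<close> is not limited. As it is bounded, the reason must be a
  weak* null sequence that does not converge uniformly on it.\<close>

lemma JN_property_if_GP:
  assumes GP: "GP_property Y" and T: "\<not> beta_to_beta_precompact E Y T"
  shows "JN_property E"
proof -
  obtain B where B: "barrel_bounded E B" "\<not> barrel_precompact Y (T ` B)"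
    using T unfolding beta_to_beta_precompact_def by blast
  then have "\<not> limited Y (T ` B)" using GP unfolding GP_property_def by blast
  then obtain \<phi> where "weak_star_null Y \<phi>" "\<not> (\<lambda>n. sup_norm_on Y (T ` B) (\<phi> n)) \<longlonglongrightarrow> 0"
    using cod.barrel_bounded_imp_bounded[OF barrel_bounded_image[OF B(1)]] unfolding limited_def by blast
  then show ?thesis using B(1) by (intro JN_property_pullback)
qed

lemma JN_property_if_strong_GP:
  assumes GP: "strong_GP_property Y" and T: "\<not> beta_to_beta_precompact E Y T"
  shows "JN_property E"
proof -
  obtain B where B: "barrel_bounded E B" "\<not> barrel_precompact Y (T ` B)"
    using T unfolding beta_to_beta_precompact_def by blast
  obtain \<phi> where "weak_star_null Y \<phi>" "\<not> (\<lambda>n. sup_norm_on Y (T ` B) (\<phi> n)) \<longlonglongrightarrow> 0"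
    using GP barrel_bounded_image[OF B(1)] B(2) unfolding strong_GP_property_def by blast
  then show ?thesis using B(1) by (intro JN_property_pullback)
qed

end

section \<open>Copies of the null sequences\<close>

text \<open>Transporting \<^const>\<open>Cp0\<close> along an injection \<open>h\<close> treats \<^const>\<open>Cp0\<close> itself and its copy in the
  universe type at once.\<close>

definition c0_copy :: "((nat \<Rightarrow> 'k::{real_normed_field, euclidean_space}) \<Rightarrow> 'b) \<Rightarrow> ('k, 'b) tvs"
  where "c0_copy h =
    \<lparr> carrier = h ` {f. f \<longlonglongrightarrow> 0},
      monoid.mult = (\<lambda>x y. h (\<lambda>n. inv_into UNIV h x n * inv_into UNIV h y n)), one = h (\<lambda>n. 1),
      zero = h (\<lambda>n. 0), add = (\<lambda>x y. h (\<lambda>n. inv_into UNIV h x n + inv_into UNIV h y n)),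
      smult = (\<lambda>c x. h (\<lambda>n. c * inv_into UNIV h x n)),
      vtop = pullback_topology (h ` {f. f \<longlonglongrightarrow> 0}) (inv_into UNIV h)
        (product_topology (\<lambda>_. euclidean) UNIV) \<rparr>"

lemma c0_copy_id: "c0_copy id = Cp0"
proof -
  have "pullback_topology A id S = subtopology S A" for S :: "'b topology" and A
    by (auto simp: topology_eq openin_pullback_topology openin_subtopology)
  then show ?thesis
    by (simp add: c0_copy_def Cp0_def inv_id)
qed

text \<open>A basic open set of the product restricts only finitely many coordinates.\<close>

lemma product_topology_nbhd0:
  fixes G :: "(nat \<Rightarrow> 'k::real_normed_vector) set"
  assumes G: "openin (product_topology (\<lambda>_. euclidean) UNIV) G" "(\<lambda>_. 0) \<in> G"
  obtains N \<epsilon> where "\<epsilon> > 0" "\<And>f. (\<And>n. n < N \<Longrightarrow> norm (f n) < \<epsilon>) \<Longrightarrow> f \<in> G"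
proof -
  obtain S where S: "(\<lambda>_. 0) \<in> Pi\<^sub>E UNIV S" "\<And>i. open (S i)" "finite {i. S i \<noteq> UNIV}" "Pi\<^sub>E UNIV S \<subseteq> G"
    using product_topology_open_contains_basis[OF G] by auto
  define I where "I = {i. S i \<noteq> UNIV}"
  have "\<exists>e>0. ball 0 e \<subseteq> S i" for i using S(1,2) open_contains_ball by blast
  then obtain e where e: "\<And>i. e i > 0" "\<And>i. ball 0 (e i) \<subseteq> S i" by metis
  \<comment> \<open>Inserting 1 here and 0 below keeps \<open>Min\<close> and \<open>Max\<close>
    meaningful when no coordinate is restricted.\<close>
  define \<epsilon> where "\<epsilon> = Min (insert 1 (e ` I))"
  define N where "N = Suc (Max (insert 0 I))"
  have I: "finite I" using S(3) by (simp add: I_def)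
  have "\<epsilon> > 0" using I e(1) by (auto simp: \<epsilon>_def)
  moreover have "f \<in> G" if f: "\<And>n. n < N \<Longrightarrow> norm (f n) < \<epsilon>" for f
  proof -
    have "f i \<in> S i" for i
    proof (cases "i \<in> I")
      case True
      then have "i < N" using I by (auto simp: N_def less_Suc_eq_le)
      moreover have "\<epsilon> \<le> e i" using I True by (auto simp: \<epsilon>_def intro!: Min_le)
      ultimately have "f i \<in> ball 0 (e i)" using f[of i] by simp
      then show ?thesis using e(2) by blast
    qed (simp add: I_def)
    then show ?thesis using S(4) by blast
  qed
  ultimately show ?thesis by (rule that)
qed

text \<open>A Cauchy sequence for the sup metric is uniformly Cauchy, and uniform limits of bounded
  continuous functions are again such. This supplies the completeness for the Baire category
  theorem.\<close>

lemma completely_metrizable_space_bcontfun: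
  "completely_metrizable_space (euclidean :: ('a::topological_space \<Rightarrow>\<^sub>C 'b::complete_space) topology)"
proof -
  have "complete (UNIV :: ('a \<Rightarrow>\<^sub>C 'b) set)"
  proof (rule completeI)
    fix f :: "nat \<Rightarrow> 'a \<Rightarrow>\<^sub>C 'b" assume "Cauchy f"
    then have "\<forall>e>0. \<exists>N. \<forall>m n x. N \<le> m \<and> N \<le> n \<and> True \<longrightarrow> dist (f m x) (f n x) < e"
      unfolding Cauchy_def by (metis dist_fun_lt_imp_dist_val_lt)
    then obtain g where "uniform_limit UNIV f g sequentially"
      using uniformly_convergent_eq_cauchy[of "\<lambda>_. True" f]
      unfolding uniform_limit_sequentially_iff by auto
    from uniform_limit_bcontfunE[OF this sequentially_bot] obtain l where "f \<longlonglongrightarrow> l" by metis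
    then show "\<exists>l\<in>UNIV. f \<longlonglongrightarrow> l" by blast
  qed
  then show ?thesis using Met_TC.completely_metrizable_space_mtopology by auto
qed

locale null_seq_copy =
  fixes h :: "(nat \<Rightarrow> 'k::{real_normed_field, euclidean_space}) \<Rightarrow> 'b"
  assumes inj: "inj h"
begin

abbreviation Y :: "('k, 'b) tvs" where "Y \<equiv> c0_copy h"

abbreviation coord :: "'b \<Rightarrow> nat \<Rightarrow> 'k" where "coord \<equiv> inv_into UNIV h"

lemma coord_h [simp]: "coord (h f) = f"
  using inj by simp

lemma carrier_c0: "carrier Y = h ` {f. f \<longlonglongrightarrow> 0}"
  by (simp add: c0_copy_def)

lemma mem_carrier_c0 [simp]: "h f \<in> carrier Y \<longleftrightarrow> f \<longlonglongrightarrow> 0"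
  using inj by (auto simp: carrier_c0 inj_image_mem_iff)

lemma carrier_c0E:
  assumes "y \<in> carrier Y"
  obtains f where "y = h f" "f \<longlonglongrightarrow> 0"
  using assms unfolding carrier_c0 by blast

lemma
  shows zero_c0: "\<zero>\<^bsub>Y\<^esub> = h (\<lambda>n. 0)"
    and add_c0: "x \<oplus>\<^bsub>Y\<^esub> y = h (\<lambda>n. coord x n + coord y n)"
    and smult_c0: "c \<odot>\<^bsub>Y\<^esub> x = h (\<lambda>n. c * coord x n)"
    and vtop_c0: "vtop Y = pullback_topology (carrier Y) coord (product_topology (\<lambda>_. euclidean) UNIV)"
  by (simp_all add: c0_copy_def)

lemma topspace_c0: "topspace (vtop Y) = carrier Y"
  by (simp add: vtop_c0 topspace_pullback_topology)

section \<open>The null sequences as a locally convex space\<close>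

lemma vectorspace_c0: "vectorspace scalars Y"
proof -
  have "field (scalars :: 'k ring)" by (rule field_from_type_algebra)
  moreover have "abelian_group Y"
  proof (rule abelian_groupI)
    fix x assume "x \<in> carrier Y"
    then obtain f where f: "x = h f" "f \<longlonglongrightarrow> 0" by (rule carrier_c0E)
    then have "h (\<lambda>n. - f n) \<in> carrier Y" using tendsto_minus[OF f(2)] by simp
    then show "\<exists>y\<in>carrier Y. y \<oplus>\<^bsub>Y\<^esub> x = \<zero>\<^bsub>Y\<^esub>"
      by (rule bexI[rotated]) (simp add: f add_c0 zero_c0)
  qed (auto elim!: carrier_c0E simp: add_c0 zero_c0 algebra_simps intro!: tendsto_add_zero)
  ultimately have "module scalars Y"
    by (intro moduleI) (auto elim!: carrier_c0E intro!: tendsto_mult_right_zero domain.axioms(1) field.axioms(1)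
        simp: add_c0 smult_c0 ring_of_type_algebra_def algebra_simps)
  then show ?thesis using \<open>field scalars\<close> by (simp add: vectorspace_def)
qed

lemma continuous_map_coord: "continuous_map (vtop Y) euclidean (\<lambda>y. coord y n)"
  using continuous_map_pullback[OF continuous_map_product_coordinates[of n UNIV "\<lambda>_. euclidean"]]
  by (simp add: vtop_c0 o_def)

lemma continuous_map_into_c0:
  assumes "\<And>x. x \<in> topspace S \<Longrightarrow> g x \<in> carrier Y"
    and "\<And>n. continuous_map S euclidean (\<lambda>x. coord (g x) n)"
  shows "continuous_map S (vtop Y) g"
  unfolding vtop_c0 using assms
  by (intro continuous_map_pullback') (auto simp: continuous_map_componentwise_UNIV)

text \<open>The convex neighbourhood is an open ball of the seminorm summing the norms of the first
  \<open>N\<close> coordinates. This seminorm is continuous as a finite sum and dominates each of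
  these coordinates.\<close>

lemma nbhd0_c0:
  assumes "nbhd0 Y U"
  shows "\<exists>V. nbhd0 Y V \<and> convex_in Y V \<and> V \<subseteq> U"
proof -
  obtain W where W: "openin (vtop Y) W" "\<zero>\<^bsub>Y\<^esub> \<in> W" "W \<subseteq> U" using assms unfolding nbhd0_def by blast
  obtain G where G: "openin (product_topology (\<lambda>_. euclidean) UNIV) G" "W = coord -` G \<inter> carrier Y"
    using W(1) unfolding vtop_c0 openin_pullback_topology by blast
  have "(\<lambda>_. 0) \<in> G" using W(2) by (simp add: G(2) zero_c0)
  then obtain N \<epsilon> where \<epsilon>: "\<epsilon> > 0" "\<And>f. (\<And>n. n < N \<Longrightarrow> norm (f n) < \<epsilon>) \<Longrightarrow> f \<in> G"
    using product_topology_nbhd0[OF G(1)] by metis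
  let ?p = "\<lambda>y. \<Sum>n<N. norm (coord y n)"
  define V where "V = {y \<in> topspace (vtop Y). ?p y \<in> {..<\<epsilon>}}"
  have "openin (vtop Y) V" unfolding V_def
    by (rule openin_continuous_map_preimage[where Y=euclidean])
      (auto intro!: continuous_map_sum continuous_map_norm continuous_map_coord)
  moreover have "\<zero>\<^bsub>Y\<^esub> \<in> V" using \<epsilon>(1) by (simp add: V_def topspace_c0 zero_c0)
  ultimately have "nbhd0 Y V" unfolding nbhd0_def by (auto simp: V_def topspace_c0)
  moreover have "V \<subseteq> U"
  proof
    fix y assume y: "y \<in> V"
    have "norm (coord y n) < \<epsilon>" if "n < N" for n
    proof -
      have "norm (coord y n) \<le> ?p y" using that by (intro member_le_sum) auto
      then show ?thesis using y by (simp add: V_def)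
    qed
    then have "coord y \<in> G" by (rule \<epsilon>(2))
    then show "y \<in> U" using y W(3) by (auto simp: G(2) V_def topspace_c0)
  qed
  moreover have "convex_in Y V"
    unfolding convex_in_def
  proof (intro conjI ballI)
    show "V \<subseteq> carrier Y" by (auto simp: V_def topspace_c0)
    fix x y and t :: real assume x: "x \<in> V" and y: "y \<in> V" and t: "t \<in> {0..1}"
    obtain f g where f: "x = h f" "f \<longlonglongrightarrow> 0" and g: "y = h g" "g \<longlonglongrightarrow> 0"
      using x y by (auto simp: V_def topspace_c0 elim!: carrier_c0E)
    let ?z = "\<lambda>n. of_real (1 - t) * f n + of_real t * g n"
    have "(\<Sum>n<N. norm (?z n)) \<le> (\<Sum>n<N. (1 - t) * norm (f n) + t * norm (g n))"
      using t by (intro sum_mono order_trans[OF norm_triangle_ineq])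
        (simp add: norm_mult del: of_real_diff)
    also have "\<dots> = (1 - t) * (\<Sum>n<N. norm (f n)) + t * (\<Sum>n<N. norm (g n))"
      by (simp add: sum.distrib sum_distrib_left)
    also have "\<dots> < \<epsilon>"
      using x y t by (intro convex_bound_lt) (simp_all add: V_def f g)
    finally have "(\<Sum>n<N. norm (?z n)) < \<epsilon>" .
    moreover have "?z \<longlonglongrightarrow> 0" using f(2) g(2)
      by (intro tendsto_add_zero tendsto_mult_right_zero)
    ultimately show "of_real (1 - t) \<odot>\<^bsub>Y\<^esub> x \<oplus>\<^bsub>Y\<^esub> of_real t \<odot>\<^bsub>Y\<^esub> y \<in> V"
      by (simp add: V_def topspace_c0 add_c0 smult_c0 f g del: of_real_diff)
  qed
  ultimately show ?thesis by blast
qed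

text \<open>The unit sequences \<open>u n\<close> form an infinite independent set, because the
  \<open>n\<close>-th coordinate of a linear combination of them isolates the coefficient of
  \<open>u n\<close>.\<close>

lemma not_fin_dim_c0: "\<not> vectorspace.fin_dim scalars Y"
proof
  interpret vectorspace scalars Y by (rule vectorspace_c0)
  assume fd: "fin_dim"
  define u where "u n = h (\<lambda>m. if m = n then 1 else 0)" for n
  have uc: "u n \<in> carrier Y" for n
  proof -
    have "(\<lambda>m. if m = n then 1 else 0 :: 'k) \<longlonglongrightarrow> 0"
      by (rule tendsto_eventually) (use eventually_gt_at_top[of n] in eventually_elim, simp)
    then show ?thesis by (simp add: u_def)
  qed
  have "inj u"
  proof (rule injI)
    fix m n assume "u m = u n"
    then have "coord (u m) m = coord (u n) m" by simp
    then show "m = n" by (simp add: u_def split: if_splits)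
  qed
  have coord_lincomb: "coord (lincomb a A) n = (\<Sum>v\<in>A. a v * coord v n)"
    if "finite A" "A \<subseteq> carrier Y" for a A n
    using that
  proof (induction A rule: finite_induct)
    case empty
    then show ?case by (simp add: lincomb_def zero_c0)
  next
    case (insert v A)
    have "a v \<odot>\<^bsub>Y\<^esub> w \<in> carrier Y" if "w \<in> carrier Y" for v w
      using that by (simp add: ring_of_type_algebra_def)
    then have "lincomb a (insert v A) = a v \<odot>\<^bsub>Y\<^esub> v \<oplus>\<^bsub>Y\<^esub> lincomb a A"
      using insert unfolding lincomb_def by (intro M.finsum_insert) auto
    then show ?case using insert by (simp add: add_c0 smult_c0)
  qed
  have "lin_indpt (range u)"
  proof
    assume "lin_dep (range u)"
    then obtain A a v where A: "finite A" "A \<subseteq> range u" "lincomb a A = \<zero>\<^bsub>Y\<^esub>" "v \<in> A" "a v \<noteq> \<zero>\<^bsub>scalars\<^esub>"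
      unfolding lin_dep_def by blast
    obtain n where n: "v = u n" using A by blast
    have "coord (lincomb a A) n = (\<Sum>w\<in>A. a w * coord w n)"
      using A(1,2) uc by (intro coord_lincomb) auto
    also have "\<dots> = (\<Sum>w\<in>A. if w = v then a v else 0)"
    proof (rule sum.cong)
      have "coord (u m) n = (if u m = u n then 1 else 0)" for m
        unfolding inj_eq[OF \<open>inj u\<close>] by (simp add: u_def)
      then show "a w * coord w n = (if w = v then a v else 0)" if "w \<in> A" for w
        using that A(2) by (auto simp: n)
    qed simp
    also have "\<dots> = a v" using A(1,4) by simp
    finally show False using A(3,5) by (simp add: zero_c0 ring_of_type_algebra_def)
  qed
  then have "finite (range u)" using fin_dim_li_fin[OF fd] uc by blast
  then show False using \<open>inj u\<close> by (simp add: finite_image_iff)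
qed

lemma lcs_c0: "lcs Y"
  unfolding lcs_def
proof (intro conjI)
  let ?P = "prod_topology (vtop Y) (vtop Y)"
  have fst: "continuous_map ?P euclidean (\<lambda>p. coord (fst p) n)"
    and snd: "continuous_map ?P euclidean (\<lambda>p. coord (snd p) n)" for n
    using continuous_map_compose[OF continuous_map_fst continuous_map_coord]
      continuous_map_compose[OF continuous_map_snd continuous_map_coord] by (simp_all add: o_def)
  show "continuous_map ?P (vtop Y) (\<lambda>(x, y). x \<oplus>\<^bsub>Y\<^esub> y)"
  proof (rule continuous_map_into_c0)
    show "(\<lambda>(x, y). x \<oplus>\<^bsub>Y\<^esub> y) p \<in> carrier Y" if "p \<in> topspace ?P" for p
      using that by (auto simp: topspace_c0 add_c0 elim!: carrier_c0E intro: tendsto_add_zero)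
    show "continuous_map ?P euclidean (\<lambda>p. coord ((\<lambda>(x, y). x \<oplus>\<^bsub>Y\<^esub> y) p) n)" for n
      using continuous_map_add[OF fst[of n] snd[of n]] by (simp add: add_c0 split_beta)
  qed
  let ?Q = "prod_topology (euclidean :: 'k topology) (vtop Y)"
  have snd: "continuous_map ?Q euclidean (\<lambda>p. coord (snd p) n)" for n
    using continuous_map_compose[OF continuous_map_snd continuous_map_coord] by (simp add: o_def)
  have fst: "continuous_map ?Q euclidean fst" by (rule continuous_map_fst)
  show "continuous_map ?Q (vtop Y) (\<lambda>(c, x). c \<odot>\<^bsub>Y\<^esub> x)"
  proof (rule continuous_map_into_c0)
    show "(\<lambda>(c, x). c \<odot>\<^bsub>Y\<^esub> x) p \<in> carrier Y" if "p \<in> topspace ?Q" for p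
      using that by (auto simp: topspace_c0 smult_c0 elim!: carrier_c0E intro: tendsto_mult_right_zero)
    have "continuous_map ?Q euclidean (\<lambda>p. fst p * coord (snd p) n)" for n
      using fst snd[of n] by (simp add: continuous_map_atin tendsto_mult)
    then show "continuous_map ?Q euclidean (\<lambda>p. coord ((\<lambda>(c, x). c \<odot>\<^bsub>Y\<^esub> x) p) n)" for n
      by (simp add: smult_c0 split_beta)
  qed
  \<comment> \<open>A continuous injection into a Hausdorff space forces its domain to be
    Hausdorff.\<close>
  have "continuous_map (vtop Y) (product_topology (\<lambda>_. euclidean) UNIV) coord"
    using continuous_map_coord by (simp add: continuous_map_componentwise_UNIV)
  moreover have "inj_on coord (topspace (vtop Y))"
    by (rule inj_onI) (auto simp: topspace_c0 elim!: carrier_c0E)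
  ultimately show "Hausdorff_space (vtop Y)"
    by (rule Hausdorff_space_injective_preimage[rotated]) (simp add: Hausdorff_space_product_topology)
  show "\<forall>U. nbhd0 Y U \<longrightarrow> (\<exists>V. nbhd0 Y V \<and> convex_in Y V \<and> V \<subseteq> U)"
    by (intro allI impI nbhd0_c0)
qed (rule vectorspace_c0 topspace_c0 not_fin_dim_c0)+

section \<open>Barrels and barrel-precompact sets of null sequences\<close>

sublocale lcs_space Y
  by unfold_locales (rule lcs_c0)

text \<open>The ball is closed as an intersection of conditions on single coordinates, and absorbing
  because null sequences are bounded.\<close>

lemma barrel_sup_ball:
  assumes "\<epsilon> > 0"
  shows "barrel Y {y \<in> carrier Y. \<forall>n. norm (coord y n) \<le> \<epsilon>}" (is "barrel Y ?U")
  unfolding barrel_def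
proof (intro conjI)
  have "closedin (vtop Y) (\<Inter>n. {y \<in> topspace (vtop Y). coord y n \<in> cball 0 \<epsilon>})"
    by (intro closedin_INT closedin_continuous_map_preimage[OF continuous_map_coord]) auto
  also have "(\<Inter>n. {y \<in> topspace (vtop Y). coord y n \<in> cball 0 \<epsilon>}) = ?U"
    by (auto simp: topspace_c0)
  finally show "closedin (vtop Y) ?U" .
  show "abs_convex_in Y ?U"
    unfolding abs_convex_in_def
  proof (intro conjI ballI allI impI)
    fix x y and a b :: 'k assume x: "x \<in> ?U" and y: "y \<in> ?U" and ab: "norm a + norm b \<le> 1"
    have "norm (a * coord x n + b * coord y n) \<le> \<epsilon>" for n
    proof -
      have "norm (a * coord x n + b * coord y n) \<le> norm a * norm (coord x n) + norm b * norm (coord y n)"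
        by (rule order_trans[OF norm_triangle_ineq]) (simp add: norm_mult)
      also have "\<dots> \<le> norm a * \<epsilon> + norm b * \<epsilon>"
        using x y by (intro add_mono mult_left_mono) auto
      also have "\<dots> = (norm a + norm b) * \<epsilon>" by (simp add: algebra_simps)
      also have "\<dots> \<le> 1 * \<epsilon>" using ab assms by (intro mult_right_mono) auto
      finally show ?thesis by simp
    qed
    moreover have "a \<odot>\<^bsub>Y\<^esub> x \<oplus>\<^bsub>Y\<^esub> b \<odot>\<^bsub>Y\<^esub> y \<in> carrier Y" using x y by simp
    ultimately show "a \<odot>\<^bsub>Y\<^esub> x \<oplus>\<^bsub>Y\<^esub> b \<odot>\<^bsub>Y\<^esub> y \<in> ?U"
      by (simp add: add_c0 smult_c0)
  qed blast
  have "absorbs Y ?U {y}" if y: "y \<in> carrier Y" for y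
  proof -
    obtain f where f: "y = h f" "f \<longlonglongrightarrow> 0" using y by (rule carrier_c0E)
    obtain M where M: "M > 0" "\<And>n. norm (f n) \<le> M"
      using convergent_imp_bounded[OF f(2)] by (auto simp: bounded_pos)
    have "{y} \<subseteq> scale_set Y c ?U" if c: "norm c \<ge> M / \<epsilon>" for c
    proof -
      have c0: "norm c > 0" using less_le_trans[OF divide_pos_pos[OF M(1) assms] c] .
      have "norm (inverse c * f n) \<le> \<epsilon>" for n
      proof -
        have "norm (f n) \<le> \<epsilon> * norm c" using M(2)[of n] c assms by (simp add: field_simps)
        then show ?thesis using c0 by (simp add: norm_mult norm_inverse norm_divide field_simps)
      qed
      then have "inverse c \<odot>\<^bsub>Y\<^esub> y \<in> ?U" using smult_closed[OF y] f by (simp add: smult_c0)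
      then show ?thesis using mem_scale_set_iff[of ?U c y] c0 y by simp
    qed
    then show ?thesis using M(1) assms unfolding absorbs_def by (intro exI[of _ "M / \<epsilon>"]) simp
  qed
  then show "absorbing Y ?U" unfolding absorbing_def by blast
qed

text \<open>Barrels are norm-closed subsets of the Banach space of null sequences, so the Baire category
  theorem applies to the multiples of a barrel.\<close>

lemma barrel_contains_sup_ball:
  assumes U: "barrel Y U"
  obtains \<delta> where "\<delta> > 0" "{y \<in> carrier Y. \<forall>n. norm (coord y n) \<le> \<delta>} \<subseteq> U"
proof -
  have U': "closedin (vtop Y) U" "abs_convex_in Y U" "absorbing Y U" "U \<subseteq> carrier Y"
    using U unfolding barrel_def abs_convex_in_def by blast+
  \<comment> \<open>Since \<open>nat\<close> is discrete, the bounded continuous functions on it are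
    all bounded sequences; \<open>C\<close> is the Banach space of null sequences with the sup
    metric.\<close>
  define C where "C = {F :: nat \<Rightarrow>\<^sub>C 'k. apply_bcontfun F \<longlonglongrightarrow> 0}"
  have lift: "\<exists>F\<in>C. apply_bcontfun F = f" if "f \<longlonglongrightarrow> 0" for f
  proof -
    have "f \<in> bcontfun" using convergent_imp_bounded[OF that] by (simp add: bcontfun_def)
    then show ?thesis using that unfolding C_def by (metis bcontfunE mem_Collect_eq)
  qed
  have "closed C"
  proof -
    have "F \<in> C" if F: "F \<in> closure C" for F
      unfolding C_def mem_Collect_eq
    proof (rule tendstoI)
      fix e :: real assume e: "e > 0"
      then obtain G where G: "G \<in> C" "dist G F < e / 2"
        using F unfolding closure_approachable by (meson half_gt_zero)
      have "\<forall>\<^sub>F n in sequentially. dist (apply_bcontfun G n) 0 < e / 2"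
        using G(1) e unfolding C_def mem_Collect_eq by (intro tendstoD[where e="e / 2"]) simp_all
      then show "\<forall>\<^sub>F n in sequentially. dist (apply_bcontfun F n) 0 < e"
      proof eventually_elim
        case (elim n)
        have "dist (apply_bcontfun F n) (apply_bcontfun G n) < e / 2"
          using dist_fun_lt_imp_dist_val_lt[OF G(2), of n] by (simp add: dist_commute)
        then show ?case using elim dist_triangle_half_r[of "apply_bcontfun G n" "apply_bcontfun F n" e 0]
          by (simp add: dist_commute)
      qed
    qed
    then show ?thesis by (simp add: closure_subset_eq[symmetric] subsetI)
  qed
  \<comment> \<open>This is the multiple of \<open>U\<close> by \<open>Suc n\<close>, lifted to
    \<open>C\<close>; the successor avoids dividing by zero.\<close>
  define A where "A n = {F \<in> C. of_real (1 / Suc n) \<odot>\<^bsub>Y\<^esub> h (apply_bcontfun F) \<in> U}" for n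
  have eval: "continuous_map (top_of_set C) euclidean (\<lambda>F. apply_bcontfun F k)" for k
  proof -
    have "continuous_on C (\<lambda>F. apply_bcontfun F k)"
      unfolding continuous_on_iff by (metis dist_fun_lt_imp_dist_val_lt)
    then show ?thesis by simp
  qed
  have "closedin (top_of_set C) (A n)" for n
  proof -
    \<comment> \<open>The sup metric is finer than the pointwise topology, so the closed set
      \<open>U\<close> pulls back to a closed set.\<close>
    have "continuous_map (top_of_set C) (vtop Y) (\<lambda>F. h (apply_bcontfun F))"
      using eval by (intro continuous_map_into_c0) (auto simp: C_def)
    then have "continuous_map (top_of_set C) (vtop Y) (\<lambda>F. of_real (1 / Suc n) \<odot>\<^bsub>Y\<^esub> h (apply_bcontfun F))"
      by (intro continuous_map_smult) simp_all
    from closedin_continuous_map_preimage[OF this U'(1)] show ?thesis by (simp add: A_def)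
  qed
  moreover have "(\<Union>n. A n) = C"
  proof
    show "C \<subseteq> (\<Union>n. A n)"
    proof
      fix F assume F: "F \<in> C"
      then have y: "h (apply_bcontfun F) \<in> carrier Y" by (simp add: C_def)
      then obtain r where r: "r > 0" "\<And>c. norm c \<ge> r \<Longrightarrow> {h (apply_bcontfun F)} \<subseteq> scale_set Y c U"
        using U'(3) unfolding absorbing_def absorbs_def by metis
      obtain n where n: "r \<le> real n" using real_arch_simple by blast
      have "r \<le> norm (of_real (Suc n) :: 'k)" unfolding norm_of_real using n by simp
      then have "h (apply_bcontfun F) \<in> scale_set Y (of_real (Suc n)) U" using r(2) by blast
      then have "inverse (of_real (Suc n)) \<odot>\<^bsub>Y\<^esub> h (apply_bcontfun F) \<in> U"
        using mem_scale_set_iff[OF U'(4), of "of_real (Suc n)"] by (simp del: of_nat_Suc)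
      then have "F \<in> A n" using F by (simp add: A_def inverse_eq_divide del: of_nat_Suc)
      then show "F \<in> (\<Union>n. A n)" by blast
    qed
  qed (auto simp: A_def)
  moreover have "0 \<in> C" by (simp add: C_def)
  moreover have "completely_metrizable_space (top_of_set C)"
    using \<open>closed C\<close> by (intro completely_metrizable_space_closedin[OF completely_metrizable_space_bcontfun]) simp
  \<comment> \<open>Otherwise the union \<open>C\<close> of the \<open>A n\<close> would have empty
    interior in itself, although it contains 0.\<close>
  ultimately have "\<not> (\<forall>n. (top_of_set C) interior_of A n = {})"
    using Baire_category_alt[of "top_of_set C" "range A"] interior_of_topspace[of "top_of_set C"]
    by auto
  then obtain n where n: "(top_of_set C) interior_of A n \<noteq> {}" by blast
  then obtain F where F: "F \<in> (top_of_set C) interior_of A n" by blast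
  obtain \<delta> where \<delta>: "\<delta> > 0" "ball F \<delta> \<inter> C \<subseteq> A n"
    using openin_interior_of[of "top_of_set C" "A n"] F interior_of_subset[of "top_of_set C" "A n"]
    unfolding openin_contains_ball by blast
  have FC: "F \<in> C" using F interior_of_subset[of "top_of_set C" "A n"] by (auto simp: A_def)
  \<comment> \<open>A sequence bounded by \<open>r\<close>, multiplied by \<open>Suc n\<close>, has
    sup norm at most \<open>\<delta> / 2\<close> and so stays inside the open ball around
    \<open>F\<close>.\<close>
  define r where "r = of_real (1 / Suc n) * (\<delta> / 2)"
  have "y \<in> U" if y: "y \<in> carrier Y" "\<And>k. norm (coord y k) \<le> r" for y
  proof -
    obtain f where f: "y = h f" "f \<longlonglongrightarrow> 0" using y(1) by (rule carrier_c0E)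
    have "(\<lambda>k. of_real (Suc n) * f k) \<longlonglongrightarrow> 0" using f(2) by (rule tendsto_mult_right_zero)
    from lift[OF this] obtain G where G: "G \<in> C" "\<And>k. apply_bcontfun G k = of_real (Suc n) * f k" by metis
    have "norm (apply_bcontfun G k) \<le> \<delta> / 2" for k
      using y(2)[of k] by (simp add: G f r_def norm_mult field_simps del: of_nat_Suc)
    then have "norm G \<le> \<delta> / 2" by (rule norm_bound)
    \<comment> \<open>Half the difference of \<open>F + G\<close> and \<open>F - G\<close> is
      \<open>G\<close>: the unknown centre \<open>F\<close> cancels, and absolute convexity keeps
      the result in \<open>U\<close>.\<close>
    then have "F + G \<in> ball F \<delta>" "F - G \<in> ball F \<delta>" using \<delta>(1) by (simp_all add: dist_norm)
    moreover have "F + G \<in> C" "F - G \<in> C" using FC G(1)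
      by (auto simp: C_def plus_bcontfun.rep_eq minus_bcontfun.rep_eq
          intro: tendsto_add_zero tendsto_diff[where a=0 and b=0, simplified])
    ultimately have "F + G \<in> A n" "F - G \<in> A n" using \<delta>(2) by blast+
    then have "h (\<lambda>k. of_real (1 / Suc n) * (apply_bcontfun F k + apply_bcontfun G k)) \<in> U"
      "h (\<lambda>k. of_real (1 / Suc n) * (apply_bcontfun F k - apply_bcontfun G k)) \<in> U"
      by (simp_all add: A_def smult_c0 plus_bcontfun.rep_eq minus_bcontfun.rep_eq)
    moreover have "norm (1/2 :: 'k) + norm (- 1/2 :: 'k) \<le> 1" by (simp add: norm_divide)
    moreover have half: "(1/2) * (c * (a + b)) + (- 1/2) * (c * (a - b)) = c * b" for a b c :: 'k
      by (simp add: field_simps)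
    ultimately have "(1/2) \<odot>\<^bsub>Y\<^esub> h (\<lambda>k. of_real (1 / Suc n) * (apply_bcontfun F k + apply_bcontfun G k)) \<oplus>\<^bsub>Y\<^esub>
        (- 1/2) \<odot>\<^bsub>Y\<^esub> h (\<lambda>k. of_real (1 / Suc n) * (apply_bcontfun F k - apply_bcontfun G k)) \<in> U"
      using U'(2) unfolding abs_convex_in_def by blast
    also have "(1/2) \<odot>\<^bsub>Y\<^esub> h (\<lambda>k. of_real (1 / Suc n) * (apply_bcontfun F k + apply_bcontfun G k)) \<oplus>\<^bsub>Y\<^esub>
        (- 1/2) \<odot>\<^bsub>Y\<^esub> h (\<lambda>k. of_real (1 / Suc n) * (apply_bcontfun F k - apply_bcontfun G k)) =
        h (\<lambda>k. of_real (1 / Suc n) * apply_bcontfun G k)"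
      unfolding add_c0 smult_c0 coord_h by (intro arg_cong[of _ _ h] ext half)
    also have "\<dots> = y" by (simp add: G(2) f(1) del: of_nat_Suc)
    finally show ?thesis .
  qed
  moreover have "r > 0" using \<delta>(1) by (simp add: r_def)
  ultimately show ?thesis using that[of r] by blast
qed

text \<open>Every barrel contains some sup-norm ball, so a finite net for the sup norm is enough.
  From some index on zero approximates all members of \<open>A\<close>, and the finitely many
  earlier coordinates are bounded.\<close>

lemma barrel_precompact_if_uniformly_null:
  assumes A: "A \<subseteq> carrier Y" and bnd: "\<And>n. \<exists>M. \<forall>y\<in>A. norm (coord y n) \<le> M"
    and null: "\<And>\<epsilon>. \<epsilon> > 0 \<Longrightarrow> \<forall>\<^sub>F n in sequentially. \<forall>y\<in>A. norm (coord y n) \<le> \<epsilon>"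
  shows "barrel_precompact Y A"
  unfolding barrel_precompact_def
proof (intro conjI A allI impI)
  fix U assume "barrel Y U"
  then obtain \<delta> where \<delta>: "\<delta> > 0" "{y \<in> carrier Y. \<forall>n. norm (coord y n) \<le> \<delta>} \<subseteq> U"
    by (rule barrel_contains_sup_ball)
  obtain N where N: "\<And>n y. n \<ge> N \<Longrightarrow> y \<in> A \<Longrightarrow> norm (coord y n) \<le> \<delta>"
    using null[OF \<delta>(1)] unfolding eventually_sequentially by blast
  \<comment> \<open>Closed balls of the scalar field are compact, hence totally bounded.\<close>
  have "\<exists>Z. finite Z \<and> (\<forall>y\<in>A. \<exists>z\<in>Z. norm (coord y n - z) \<le> \<delta>)" for n
  proof -
    obtain M where M: "\<And>y. y \<in> A \<Longrightarrow> norm (coord y n) \<le> M" using bnd by blast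
    have "compact (cball (0::'k) M)" by simp
    then obtain Z :: "'k set" where Z: "finite Z" "cball 0 M \<subseteq> (\<Union>z\<in>Z. ball z \<delta>)"
      using seq_compact_imp_totally_bounded[of "cball (0::'k) M"] \<delta>(1)
      unfolding compact_eq_seq_compact_metric by meson
    have "\<exists>z\<in>Z. norm (coord y n - z) \<le> \<delta>" if "y \<in> A" for y
    proof -
      have "coord y n \<in> cball 0 M" using M[OF that] by simp
      then obtain z where "z \<in> Z" "coord y n \<in> ball z \<delta>" using Z(2) by blast
      then show ?thesis by (intro bexI[of _ z]) (simp_all add: dist_norm norm_minus_commute)
    qed
    then show ?thesis using Z(1) by blast
  qed
  then obtain Z where Z: "\<And>n. finite (Z n)" "\<And>n y. y \<in> A \<Longrightarrow> \<exists>z\<in>Z n. norm (coord y n - z) \<le> \<delta>"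
    by metis
  define E where "E f = h (\<lambda>n. if n < N then f n else 0)" for f
  define F where "F = E ` (Pi\<^sub>E {..<N} Z)"
  have Ec: "E f \<in> carrier Y" for f
    unfolding E_def mem_carrier_c0
    by (rule tendsto_eventually) (use eventually_ge_at_top[of N] in eventually_elim, simp)
  have "finite F" unfolding F_def using Z(1) by (intro finite_imageI finite_PiE) auto
  moreover have "F \<subseteq> carrier Y" unfolding F_def using Ec by blast
  moreover have "A \<subseteq> F <+>\<^bsub>Y\<^esub> U"
  proof
    fix y assume y: "y \<in> A"
    obtain z where z: "\<And>n. z n \<in> Z n" "\<And>n. norm (coord y n - z n) \<le> \<delta>" using Z(2)[OF y] by metis
    obtain f where f: "y = h f" "f \<longlonglongrightarrow> 0" using y A by (blast elim: carrier_c0E)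
    define g where "g = restrict z {..<N}"
    have g: "E g \<in> F" using z(1) by (auto simp: F_def g_def)
    define u where "u = y \<oplus>\<^bsub>Y\<^esub> (-1) \<odot>\<^bsub>Y\<^esub> E g"
    have "u \<in> carrier Y" using y A Ec by (auto simp: u_def)
    moreover have "norm (coord u n) \<le> \<delta>" for n
      using z(2)[of n] N[OF _ y, of n] by (auto simp: u_def E_def g_def add_c0 smult_c0)
    ultimately have "u \<in> U" using \<delta>(2) by blast
    moreover have "y = E g \<oplus>\<^bsub>Y\<^esub> u" by (simp add: u_def add_c0 smult_c0 f)
    ultimately show "y \<in> F <+>\<^bsub>Y\<^esub> U" using g unfolding set_add_def' by blast
  qed
  ultimately show "\<exists>F. finite F \<and> F \<subseteq> carrier Y \<and> A \<subseteq> F <+>\<^bsub>Y\<^esub> U" by blast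
qed

text \<open>Applied to a sup-norm ball, precompactness puts \<open>A\<close> within
  \<open>\<epsilon> / 2\<close> of finitely many null sequences, and these are eventually small
  simultaneously.\<close>

lemma uniformly_null_if_barrel_precompact:
  assumes A: "barrel_precompact Y A" and \<epsilon>: "\<epsilon> > 0"
  shows "\<forall>\<^sub>F n in sequentially. \<forall>y\<in>A. norm (coord y n) \<le> \<epsilon>"
proof -
  obtain F where F: "finite F" "F \<subseteq> carrier Y"
      "A \<subseteq> F <+>\<^bsub>Y\<^esub> {y \<in> carrier Y. \<forall>n. norm (coord y n) \<le> \<epsilon> / 2}"
    using A barrel_sup_ball[of "\<epsilon> / 2"] \<epsilon> unfolding barrel_precompact_def by (meson half_gt_zero)
  have "\<forall>\<^sub>F n in sequentially. norm (coord x n) < \<epsilon> / 2" if x: "x \<in> F" for x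
  proof -
    have "coord x \<longlonglongrightarrow> 0" using x F(2) by (auto elim!: carrier_c0E)
    then have "(\<lambda>n. norm (coord x n)) \<longlonglongrightarrow> 0" by (rule tendsto_norm_zero)
    then show ?thesis using \<epsilon> by (intro order_tendstoD(2)) auto
  qed
  then have "\<forall>\<^sub>F n in sequentially. \<forall>x\<in>F. norm (coord x n) < \<epsilon> / 2"
    using F(1) by (intro eventually_ball_finite) auto
  then show ?thesis
  proof eventually_elim
    case (elim n)
    show ?case
    proof
      fix y assume "y \<in> A"
      then obtain x u where x: "x \<in> F" and u: "norm (coord u n) \<le> \<epsilon> / 2" "y = x \<oplus>\<^bsub>Y\<^esub> u"
        using F(3) unfolding set_add_def' by blast
      have "norm (coord y n) \<le> norm (coord x n) + norm (coord u n)"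
        unfolding u(2) add_c0 coord_h by (rule norm_triangle_ineq)
      then show "norm (coord y n) \<le> \<epsilon>" using elim x u(1) by fastforce
    qed
  qed
qed

section \<open>Coordinate functionals and the Gelfand--Phillips properties\<close>

definition coord_functional :: "nat \<Rightarrow> 'b \<Rightarrow> 'k"
  where "coord_functional n = (\<lambda>y\<in>carrier Y. coord y n)"

lemma weak_star_null_coord: "weak_star_null Y coord_functional"
  unfolding weak_star_null_iff
proof (intro conjI allI ballI)
  fix n
  have "continuous_map (vtop Y) euclidean (coord_functional n)"
    by (rule continuous_map_eq[OF continuous_map_coord[of n]]) (simp add: topspace_c0 coord_functional_def)
  then show "coord_functional n \<in> dual Y"
    by (auto simp: dual_def coord_functional_def add_closed smult_closed) (simp_all add: add_c0 smult_c0)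
next
  fix y assume "y \<in> carrier Y"
  then show "(\<lambda>n. coord_functional n y) \<longlonglongrightarrow> 0"
    by (auto simp: coord_functional_def elim!: carrier_c0E)
qed

text \<open>Assuming boundedness rather than barrel-boundedness makes this serve both properties:
  limited sets are bounded by definition, barrel-bounded sets by
  \<open>barrel_bounded_imp_bounded\<close>.\<close>

lemma barrel_precompact_if_coord_null:
  assumes A: "bounded_in Y A"
    and null: "(\<lambda>n. sup_norm_on Y A (coord_functional n)) \<longlonglongrightarrow> 0"
  shows "barrel_precompact Y A"
proof (rule barrel_precompact_if_uniformly_null)
  have d: "coord_functional n \<in> dual Y" for n using weak_star_null_coord unfolding weak_star_null_iff by blast
  show Ac: "A \<subseteq> carrier Y" using A unfolding bounded_in_def by blast
  show "\<forall>\<^sub>F n in sequentially. \<forall>y\<in>A. norm (coord y n) \<le> \<epsilon>" if "\<epsilon> > 0" for \<epsilon>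
  proof -
    have "\<forall>\<^sub>F n in sequentially. \<forall>y\<in>A. norm (coord_functional n y) \<le> \<epsilon>"
      using null that unfolding sup_norm_on_tendsto_0_iff[OF d] by blast
    then show ?thesis by eventually_elim (use Ac in \<open>auto simp: coord_functional_def subset_iff\<close>)
  qed
  fix n
  \<comment> \<open>Absorption by this neighbourhood, which restricts one coordinate only, bounds
    that coordinate on \<open>A\<close>.\<close>
  let ?U = "{y \<in> topspace (vtop Y). coord y n \<in> ball 0 1}"
  have "openin (vtop Y) ?U" by (rule openin_continuous_map_preimage[OF continuous_map_coord]) auto
  moreover have "\<zero>\<^bsub>Y\<^esub> \<in> ?U" by (simp add: topspace_c0) (simp add: zero_c0)
  ultimately have "nbhd0 Y ?U" unfolding nbhd0_def by (auto simp: topspace_c0)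
  then obtain r where r: "r > 0" "\<And>c. norm c \<ge> r \<Longrightarrow> A \<subseteq> scale_set Y c ?U"
    using A unfolding bounded_in_def absorbs_def by blast
  have "norm (coord y n) \<le> r" if "y \<in> A" for y
  proof -
    have "y \<in> scale_set Y (of_real r) ?U" using r(2)[of "of_real r"] r(1) that by auto
    then obtain x where x: "norm (coord x n) < 1" "y = of_real r \<odot>\<^bsub>Y\<^esub> x" unfolding scale_set_def by auto
    then show ?thesis using r(1) by (simp add: smult_c0 norm_mult mult_left_le)
  qed
  then show "\<exists>M. \<forall>y\<in>A. norm (coord y n) \<le> M" by blast
qed

text \<open>One sequence must work for every \<open>B\<close>, and the coordinate functionals do not
  depend on \<open>B\<close>.\<close>

lemma strong_GP_c0: "strong_GP_property Y"
  unfolding strong_GP_property_def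
  using weak_star_null_coord barrel_precompact_if_coord_null barrel_bounded_imp_bounded by blast

lemma GP_c0: "GP_property Y"
  unfolding GP_property_def limited_def
  using weak_star_null_coord barrel_precompact_if_coord_null by blast

text \<open>Weak* nullness is what makes the values of the operator null sequences, and its
  continuity may be checked coordinate by coordinate.\<close>

lemma ex_operator_if_JN:
  fixes E :: "('k, 'a) tvs"
  assumes E: "lcs E" and JN: "JN_property E"
  obtains T where "continuous_operator E Y T" "\<not> beta_to_beta_precompact E Y T"
proof -
  interpret E: lcs_space E by unfold_locales (rule E)
  obtain \<phi> B where \<phi>: "weak_star_null E \<phi>" and B: "barrel_bounded E B"
    and n0: "\<not> (\<lambda>n. sup_norm_on E B (\<phi> n)) \<longlonglongrightarrow> 0"
    using JN unfolding E.JN_property_iff by blast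
  have \<phi>d: "\<phi> n \<in> dual E" for n using \<phi> unfolding E.weak_star_null_iff by blast
  define T where "T x = h (\<lambda>n. \<phi> n x)" for x
  have Tc: "T x \<in> carrier Y" if "x \<in> carrier E" for x
    using \<phi> that unfolding T_def E.weak_star_null_iff by simp
  have "continuous_map (vtop E) (vtop Y) T"
    using Tc dualD(3)[OF \<phi>d] by (intro continuous_map_into_c0) (simp_all add: E.topspace_vtop T_def)
  moreover have "T \<in> module_hom scalars E Y"
    using Tc dualD(1,2)[OF \<phi>d] by (auto simp: module_hom_def T_def add_c0 smult_c0)
  ultimately have "continuous_operator E Y T" unfolding continuous_operator_def by blast
  moreover have "\<not> beta_to_beta_precompact E Y T"
  proof
    assume "beta_to_beta_precompact E Y T"
    then have "barrel_precompact Y (T ` B)" using B unfolding beta_to_beta_precompact_def by blast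
    then have "\<forall>\<^sub>F n in sequentially. \<forall>y\<in>T ` B. norm (coord y n) \<le> e" if "e > 0" for e
      using that by (rule uniformly_null_if_barrel_precompact)
    then have "(\<lambda>n. sup_norm_on E B (\<phi> n)) \<longlonglongrightarrow> 0"
      unfolding E.sup_norm_on_tendsto_0_iff[OF \<phi>d] by (simp add: T_def)
    then show False using n0 by blast
  qed
  ultimately show ?thesis by (rule that)
qed

end

theorem theorem2p17:
  fixes E :: "('k::{real_normed_field, euclidean_space}, 'e) tvs"
  assumes "lcs E"
  shows
    "(JN_property E \<longleftrightarrow>
        (\<exists>T. continuous_operator E Cp0 T \<and> \<not> beta_to_beta_precompact E Cp0 T)) \<and>
     (JN_property E \<longleftrightarrow>
        (\<exists>Y :: ('k, ('k, 'u) universe) tvs. lcs Y \<and> strong_GP_property Y \<and>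
          (\<exists>T. continuous_operator E Y T \<and> \<not> beta_to_beta_precompact E Y T))) \<and>
     (JN_property E \<longleftrightarrow>
        (\<exists>Y :: ('k, ('k, 'u) universe) tvs. lcs Y \<and> GP_property Y \<and>
          (\<exists>T. continuous_operator E Y T \<and> \<not> beta_to_beta_precompact E Y T)))"
proof -
  \<comment> \<open>\<open>id\<close> gives \<open>Cp0\<close> itself, \<open>Inl\<close> its copy
    in the universe type.\<close>
  interpret C: null_seq_copy "id :: (nat \<Rightarrow> 'k) \<Rightarrow> (nat \<Rightarrow> 'k)" by unfold_locales simp
  interpret L: null_seq_copy "Inl :: (nat \<Rightarrow> 'k) \<Rightarrow> ('k, 'u) universe" by unfold_locales simp
  \<comment> \<open>The carrier type of \<open>Y\<close> is left arbitrary, since the implication is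
    applied both to \<open>Cp0\<close> and to spaces on the universe type.\<close>
  have JN_if_strong_GP: "JN_property E"
    if "lcs Y" "strong_GP_property Y" "continuous_operator E Y T" "\<not> beta_to_beta_precompact E Y T"
    for Y :: "('k, 'b) tvs" and T
  proof -
    interpret lcs_operator E Y T using assms that by unfold_locales
    show ?thesis using that by (intro JN_property_if_strong_GP)
  qed
  have JN_if_GP: "JN_property E"
    if "lcs Y" "GP_property Y" "continuous_operator E Y T" "\<not> beta_to_beta_precompact E Y T"
    for Y :: "('k, 'b) tvs" and T
  proof -
    interpret lcs_operator E Y T using assms that by unfold_locales
    show ?thesis using that by (intro JN_property_if_GP)
  qed
  show ?thesis
    using JN_if_strong_GP[OF C.lcs_c0 C.strong_GP_c0] JN_if_strong_GP JN_if_GP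
      C.ex_operator_if_JN[OF assms] L.ex_operator_if_JN[OF assms] L.lcs_c0 L.strong_GP_c0 L.GP_c0
    unfolding c0_copy_id by metis
qed

end
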